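(* For any integers $k>1$ and $d\ge1$, a RAM equipped with the basic arithmetic operations and $k$-dimensional arrays, but using only $O(N)$ registers and time $O(t(N))$, can be simulated in time $O(t(N))$ and using $O(N)$ registers by a RAM equipped with the same set of operations but using only $1$-dimensional arrays and one $2$-dimensional array of dimensions $N\times\lfloor N^{1/d}\rfloor$.
   Context: A RAM operates on registers containing natural numbers $O(N)$ ($N$ the input size), under the unit cost criterion (each instruction costs one time unit), with indirect addressing. A RAM with $k$-dimensional arrays may use arrays $\mathbf A$ indexed by $k$-tuples $(n_1,\dots,n_k)$ of integers $n_i=O(N)$, each entry being readable and writable in constant time; "using only $O(N)$ registers" means that only $O(N)$ array entries are ever used. The basic arithmetic operations are addition, subtraction, multiplication, Euclidean division (and related operations such as computing $\lfloor N^{1/d}\rfloor$ and base change). *)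

theory Defs
  imports
    Complex_Main
    "HOL-Library.Landau_Symbols"
    "HOL-Computational_Algebra.Nth_Powers"
begin

text \<open>
  A RAM has registers \<open>R\<^sub>0, R\<^sub>1, \<dots>\<close> (with indirect addressing) and a fixed finite list of arrays;
  array \<open>a\<close> has dimension \<open>dims P ! a\<close>.  Registers and array entries hold natural numbers and
  are initially 0.  The input is a read-only list; its length is the input size \<open>N\<close>.
\<close>

datatype aop = Add | Sub | Mul | Div | Mod

text \<open>
  Subtraction is truncated at 0, so it also provides comparison; division by zero follows the
  HOL convention (\<open>x div 0 = 0\<close>, \<open>x mod 0 = x\<close>).
\<close>
fun aop_eval :: "aop \<Rightarrow> nat \<Rightarrow> nat \<Rightarrow> nat" where
  "aop_eval Add x y = x + y"
| "aop_eval Sub x y = x - y"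
| "aop_eval Mul x y = x * y"
| "aop_eval Div x y = x div y"
| "aop_eval Mod x y = x mod y"

text \<open>
  The numeric arguments are register numbers, except the constant of \<open>Const\<close>, the exponent of \<open>Root\<close>,
  the digit position (second argument) of \<open>Digit\<close>, the array name in \<open>ALoad\<close> and \<open>AStore\<close>, and
  the jump target of \<open>JZero\<close>.  \<open>Digit i l j b\<close> is the base change operation: it
  yields the \<open>l\<close>-th digit of \<open>R\<^sub>j\<close> in base \<open>R\<^sub>b\<close>.
\<close>
datatype instr =
    Const nat nat            (* R_i := c *)
  | Size nat                 (* R_i := N *)
  | Input nat nat            (* R_i := x[R_j], and 0 if R_j >= N *)
  | Arith aop nat nat nat    (* R_i := R_j op R_l *)
  | Root nat nat nat         (* R_i := floor (R_j ^ (1/r)), arguments r i j *)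
  | Digit nat nat nat nat    (* R_i := (R_j div R_b ^ l) mod R_b, arguments i l j b *)
  | Load nat nat             (* R_i := R_(R_j) *)
  | Store nat nat            (* R_(R_i) := R_j *)
  | ALoad nat nat "nat list"  (* R_i := A_a[R_j1, ..., R_jm], arguments i a [j1, ..., jm] *)
  | AStore nat "nat list" nat (* A_a[R_j1, ..., R_jm] := R_i, arguments a [j1, ..., jm] i *)
  | JZero nat nat            (* if R_i = 0 then goto l *)
  | Output nat               (* append R_i to the output *)
  | Halt

record ram =
  dims :: "nat list"
  code :: "instr list"

fun wf_instr :: "nat list \<Rightarrow> instr \<Rightarrow> bool" where
  "wf_instr ds (Root r i j) \<longleftrightarrow> r \<ge> 1"
| "wf_instr ds (ALoad i a js) \<longleftrightarrow> a < length ds \<and> length js = ds ! a"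
| "wf_instr ds (AStore a js i) \<longleftrightarrow> a < length ds \<and> length js = ds ! a"
| "wf_instr ds _ \<longleftrightarrow> True"

definition wf_ram :: "ram \<Rightarrow> bool" where
  "wf_ram P \<longleftrightarrow> (\<forall>ins \<in> set (code P). wf_instr (dims P) ins)"

datatype cell = Reg nat | Entry nat "nat list"

record config =
  pc :: nat
  mem :: "cell \<Rightarrow> nat"
  out :: "nat list"

definition init :: config where
  "init = \<lparr>pc = 0, mem = (\<lambda>_. 0), out = []\<rparr>"

definition entry_at :: "(cell \<Rightarrow> nat) \<Rightarrow> nat \<Rightarrow> nat list \<Rightarrow> cell" where
  "entry_at m a js = Entry a (map (\<lambda>j. m (Reg j)) js)"

definition assign :: "cell \<Rightarrow> nat \<Rightarrow> config \<Rightarrow> config" where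
  "assign c v s = s\<lparr>pc := Suc (pc s), mem := (mem s)(c := v)\<rparr>"

fun exec :: "ram \<Rightarrow> nat list \<Rightarrow> instr \<Rightarrow> config \<Rightarrow> config" where
  "exec P x (Const i c) s = assign (Reg i) c s"
| "exec P x (Size i) s = assign (Reg i) (length x) s"
| "exec P x (Input i j) s =
     assign (Reg i) (let n = mem s (Reg j) in if n < length x then x ! n else 0) s"
| "exec P x (Arith f i j l) s =
     assign (Reg i) (aop_eval f (mem s (Reg j)) (mem s (Reg l))) s"
| "exec P x (Root r i j) s = assign (Reg i) (nth_root_nat r (mem s (Reg j))) s"
| "exec P x (Digit i l j b) s =
     assign (Reg i) ((mem s (Reg j) div mem s (Reg b) ^ l) mod mem s (Reg b)) s"
| "exec P x (Load i j) s = assign (Reg i) (mem s (Reg (mem s (Reg j)))) s"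
| "exec P x (Store i j) s = assign (Reg (mem s (Reg i))) (mem s (Reg j)) s"
| "exec P x (ALoad i a js) s = assign (Reg i) (mem s (entry_at (mem s) a js)) s"
| "exec P x (AStore a js i) s = assign (entry_at (mem s) a js) (mem s (Reg i)) s"
| "exec P x (JZero i l) s = s\<lparr>pc := (if mem s (Reg i) = 0 then l else Suc (pc s))\<rparr>"
| "exec P x (Output i) s = s\<lparr>pc := Suc (pc s), out := out s @ [mem s (Reg i)]\<rparr>"
| "exec P x Halt s = s\<lparr>pc := length (code P)\<rparr>"

definition halted :: "ram \<Rightarrow> config \<Rightarrow> bool" where
  "halted P s \<longleftrightarrow> pc s \<ge> length (code P)"

definition step :: "ram \<Rightarrow> nat list \<Rightarrow> config \<Rightarrow> config" where
  "step P x s = (if halted P s then s else exec P x (code P ! pc s) s)"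

definition run :: "ram \<Rightarrow> nat list \<Rightarrow> nat \<Rightarrow> config" where
  "run P x n = (step P x ^^ n) init"

text \<open>Cells read or written by an instruction, given the memory contents before it.\<close>
fun touched :: "(cell \<Rightarrow> nat) \<Rightarrow> instr \<Rightarrow> cell set" where
  "touched m (Const i c) = {Reg i}"
| "touched m (Size i) = {Reg i}"
| "touched m (Input i j) = {Reg i, Reg j}"
| "touched m (Arith f i j l) = {Reg i, Reg j, Reg l}"
| "touched m (Root r i j) = {Reg i, Reg j}"
| "touched m (Digit i l j b) = {Reg i, Reg j, Reg b}"
| "touched m (Load i j) = {Reg i, Reg j, Reg (m (Reg j))}"
| "touched m (Store i j) = {Reg i, Reg j, Reg (m (Reg i))}"
| "touched m (ALoad i a js) = insert (Reg i) (insert (entry_at m a js) (Reg ` set js))"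
| "touched m (AStore a js i) = insert (Reg i) (insert (entry_at m a js) (Reg ` set js))"
| "touched m (JZero i l) = {Reg i}"
| "touched m (Output i) = {Reg i}"
| "touched m Halt = {}"

definition used_cells :: "ram \<Rightarrow> nat list \<Rightarrow> nat \<Rightarrow> cell set" where
  "used_cells P x n =
     (\<Union>m \<in> {m. m < n \<and> \<not> halted P (run P x m)}.
        touched (mem (run P x m)) (code P ! pc (run P x m)))"

definition computes :: "ram \<Rightarrow> nat list \<Rightarrow> nat list \<Rightarrow> bool" where
  "computes P x y \<longleftrightarrow> (\<exists>n. halted P (run P x n) \<and> out (run P x n) = y)"

text \<open>
  In the following, \<open>D\<close> is the set of admissible inputs.  Asymptotic bounds are uniform over all
  inputs of the same size.
\<close>

text \<open>All numbers handled (input entries, contents of registers and of arrays) are \<open>O(N)\<close>.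
  Hence so are all the addresses and array indices, as they are read from registers.\<close>
definition linear_values :: "ram \<Rightarrow> nat list set \<Rightarrow> bool" where
  "linear_values P D \<longleftrightarrow>
     (\<exists>V :: nat \<Rightarrow> nat. (\<lambda>N. real (V N)) \<in> O(\<lambda>N. real N) \<and>
        (\<forall>x \<in> D. (\<forall>e \<in> set x. e \<le> V (length x)) \<and>
                 (\<forall>n c. mem (run P x n) c \<le> V (length x))))"

definition linear_space :: "ram \<Rightarrow> nat list set \<Rightarrow> bool" where
  "linear_space P D \<longleftrightarrow>
     (\<exists>S :: nat \<Rightarrow> nat. (\<lambda>N. real (S N)) \<in> O(\<lambda>N. real N) \<and>
        (\<forall>x \<in> D. \<forall>n. card (used_cells P x n) \<le> S (length x)))"

definition runs_in_time :: "ram \<Rightarrow> nat list set \<Rightarrow> (nat \<Rightarrow> real) \<Rightarrow> bool" where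
  "runs_in_time P D t \<longleftrightarrow>
     (\<exists>T :: nat \<Rightarrow> nat. (\<lambda>N. real (T N)) \<in> O(t) \<and>
        (\<forall>x \<in> D. \<exists>n \<le> T (length x). halted P (run P x n)))"

definition simulates :: "ram \<Rightarrow> ram \<Rightarrow> nat list set \<Rightarrow> bool" where
  "simulates Q P D \<longleftrightarrow> (\<forall>x \<in> D. \<forall>y. computes Q x y \<longleftrightarrow> computes P x y)"

text \<open>Arrays of dimension at most \<open>k\<close>: lower-dimensional ones are allowed besides \<open>k\<close>-dimensional ones.\<close>
definition has_arrays_upto :: "nat \<Rightarrow> ram \<Rightarrow> bool" where
  "has_arrays_upto k P \<longleftrightarrow> (\<forall>e \<in> set (dims P). 1 \<le> e \<and> e \<le> k)"

definition one_2d_array :: "ram \<Rightarrow> bool" where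
  "one_2d_array Q \<longleftrightarrow> set (dims Q) \<subseteq> {1, 2} \<and> count_list (dims Q) 2 = 1"

text \<open>
  Every access to a two-dimensional array stays within \<open>{0..<N} \<times> {0..<\<lfloor>N\<^bsup>1/d\<^esup>\<rfloor>}\<close>.  In a well-formed RAM
  only such arrays are accessed with index lists of length 2.
\<close>
definition within_2d_bounds :: "nat \<Rightarrow> ram \<Rightarrow> nat list set \<Rightarrow> bool" where
  "within_2d_bounds d Q D \<longleftrightarrow>
     (\<forall>x \<in> D. \<forall>n a i j. Entry a [i, j] \<in> used_cells Q x n \<longrightarrow>
        i < length x \<and> j < nth_root_nat d (length x))"

end

(* An array cell A_a[n_1, ..., n_m] is the path spelled by the base-b digits of n_1, ..., n_m from the
   a-th root of a forest whose nodes are numbered in the order of their creation; node v holds the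
   content of the cell it represents in a one-dimensional array at index v.  A path is followed, and
   its missing nodes are created, at each access, so no initialisation is needed and the number of
   nodes is linear in the number of cells used.  With b about N^(1/d) / c, a number O(N) has a bounded
   number of digits.  The child table (node, digit) needs c N rows for the O(N) nodes; packing c nodes
   into one row makes it fit into N x floor(N^(1/d)).  For the finitely many N for which b is too
   small, b is a constant exceeding all indices, and the child table is a one-dimensional array. *)
theory Submission
  imports Defs
begin

section \<open>Guarded straight-line code\<close>

text \<open>The two-dimensional array has in general more than O(N) entries, so the number of
  entries actually touched needs its own bound. Every lookup of a missing child is followed at once
  by the creation of that child, even if \<open>P\<close> only reads. Hence between accesses all
  touched entries of this array are nonzero and name distinct nodes, so they are at most as many as
  the nodes. Nodes correspond to prefixes of digit strings of cells used by \<open>P\<close>, so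
  each such cell costs at most \<open>Suc (k * L)\<close> of them. The constants look circular:
  \<open>c\<close> must exceed the number of nodes per unit of N, which grows with the digit count
  \<open>L\<close>, while a larger \<open>c\<close> makes the base b smaller. The circle is broken
  by the fact that the root plus 1 is at most b^2 as soon as b is at least 2c. So \<open>L\<close>
  can be fixed before \<open>c\<close>, and only the threshold \<open>n1\<close> depends on
  \<open>c\<close>.\<close>

type_synonym memory = "cell \<Rightarrow> nat"

text \<open>Skipping a single instruction is the only branching needed inside a block, so the code
  is free of loops and its length bounds its running time.\<close>

datatype gins = Plain instr | Guarded nat instr

fun straight :: "instr \<Rightarrow> bool" where
  "straight (JZero i l) \<longleftrightarrow> False"
| "straight (Output i) \<longleftrightarrow> False"
| "straight Halt \<longleftrightarrow> False"
| "straight _ \<longleftrightarrow> True"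

text \<open>On straight-line instructions the program argument of \<^const>\<open>exec\<close> is irrelevant.\<close>
definition effect :: "nat list \<Rightarrow> instr \<Rightarrow> memory \<Rightarrow> memory" where
  "effect x i m = mem (exec \<lparr>dims = [], code = []\<rparr> x i (init\<lparr>mem := m\<rparr>))"

lemma exec_straight:
  "straight i \<Longrightarrow> exec P x i s = s\<lparr>pc := Suc (pc s), mem := effect x i (mem s)\<rparr>"
  by (cases i) (auto simp: effect_def assign_def Let_def)

lemma effect_simps [simp]:
  "effect x (Const i c) m = m(Reg i := c)"
  "effect x (Size i) m = m(Reg i := length x)"
  "effect x (Arith f i j l) m = m(Reg i := aop_eval f (m (Reg j)) (m (Reg l)))"
  "effect x (Root r i j) m = m(Reg i := nth_root_nat r (m (Reg j)))"
  "effect x (Digit i l j b) m =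
     m(Reg i := (m (Reg j) div m (Reg b) ^ l) mod m (Reg b))"
  "effect x (ALoad i a js) m = m(Reg i := m (entry_at m a js))"
  "effect x (AStore a js i) m = m(entry_at m a js := m (Reg i))"
  by (simp_all add: effect_def assign_def)

text \<open>Jump targets are absolute, hence the address \<open>p\<close> of the first instruction
  as an argument.\<close>

fun compile :: "nat \<Rightarrow> gins list \<Rightarrow> instr list" where
  "compile p [] = []"
| "compile p (Plain i # gs) = i # compile (p + 1) gs"
| "compile p (Guarded r i # gs) = JZero r (p + 2) # i # compile (p + 2) gs"

fun glength :: "gins list \<Rightarrow> nat" where
  "glength [] = 0"
| "glength (Plain i # gs) = 1 + glength gs"
| "glength (Guarded r i # gs) = 2 + glength gs"

lemma length_compile [simp]: "length (compile p gs) = glength gs"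
  by (induction p gs rule: compile.induct) auto

lemma glength_append [simp]: "glength (gs @ hs) = glength gs + glength hs"
  by (induction gs rule: glength.induct) auto

lemma glength_replicate [simp]: "glength (replicate n (Plain i)) = n"
  by (induction n) auto

definition bounded_mem :: "nat \<Rightarrow> memory \<Rightarrow> bool" where
  "bounded_mem B m \<longleftrightarrow> (\<forall>c. m c \<le> B)"

lemma bounded_mem_upd: "bounded_mem B m \<Longrightarrow> v \<le> B \<Longrightarrow> bounded_mem B (m(c := v))"
  by (simp add: bounded_mem_def)

lemma bounded_memD: "bounded_mem B m \<Longrightarrow> m c \<le> B"
  by (simp add: bounded_mem_def)

text \<open>
  The second argument of the postcondition collects the cells used so far; \<open>B\<close> bounds all
  intermediate memory contents.
\<close>
fun wp :: "nat list \<Rightarrow> nat \<Rightarrow> gins list \<Rightarrow> (memory \<Rightarrow> cell set \<Rightarrow> bool)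
           \<Rightarrow> memory \<Rightarrow> cell set \<Rightarrow> bool" where
  "wp x B [] \<Phi> m u \<longleftrightarrow> \<Phi> m u"
| "wp x B (Plain i # gs) \<Phi> m u \<longleftrightarrow>
     straight i \<and> bounded_mem B (effect x i m) \<and> wp x B gs \<Phi> (effect x i m) (u \<union> touched m i)"
| "wp x B (Guarded r i # gs) \<Phi> m u \<longleftrightarrow>
     (if m (Reg r) = 0 then wp x B gs \<Phi> m (insert (Reg r) u)
      else straight i \<and> bounded_mem B (effect x i m) \<and>
           wp x B gs \<Phi> (effect x i m) (insert (Reg r) u \<union> touched m i))"

lemma wp_append: "wp x B (gs @ hs) \<Phi> m u \<longleftrightarrow> wp x B gs (wp x B hs \<Phi>) m u"
proof (induction gs arbitrary: m u)
  case (Cons g gs)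
  then show ?case by (cases g) simp_all
qed simp

lemma wp_mono:
  "wp x B gs \<Phi> m u \<Longrightarrow> (\<And>m u. \<Phi> m u \<Longrightarrow> \<Psi> m u) \<Longrightarrow> wp x B gs \<Psi> m u"
proof (induction gs arbitrary: m u)
  case (Cons g gs)
  then show ?case by (cases g) (auto split: if_splits)
qed simp

section \<open>Runs and the cells they use\<close>

lemma run_0 [simp]: "run P x 0 = init"
  by (simp add: run_def)

lemma run_Suc: "run P x (Suc n) = step P x (run P x n)"
  by (simp add: run_def)

lemma used_cells_0 [simp]: "used_cells P x 0 = {}"
  by (simp add: used_cells_def)

lemma used_cells_Suc:
  "used_cells P x (Suc n) = used_cells P x n \<union>
     (if halted P (run P x n) then {}
      else touched (mem (run P x n)) (code P ! pc (run P x n)))"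
  by (auto simp: used_cells_def less_Suc_eq)

lemma finite_touched: "finite (touched m i)"
  by (cases i) auto

lemma finite_used_cells: "finite (used_cells P x n)"
  by (simp add: used_cells_def finite_touched)

lemma run_halted:
  assumes "halted P (run P x h)" "h \<le> n"
  shows "run P x n = run P x h"
  using assms(2)
proof (induction n rule: dec_induct)
  case (step n)
  then show ?case using assms(1) by (simp add: run_Suc step_def)
qed simp

lemma used_cells_halted:
  assumes "halted P (run P x h)"
  shows "used_cells P x n \<subseteq> used_cells P x h"
proof -
  have "m < h" if "\<not> halted P (run P x m)" for m
    using that assms run_halted[OF assms, of m] by (metis not_le_imp_less)
  then show ?thesis by (auto simp: used_cells_def)
qed

text \<open>Transfers symbolic execution to real runs. Boundedness is carried for every intermediate
  time because \<open>linear_values\<close> speaks of all configurations, not only of those between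
  blocks.\<close>

lemma wp_sound:
  assumes "wp x B gs \<Phi> (mem (run Q x n)) (used_cells Q x n)"
    and "pc (run Q x n) = p"
    and "\<And>j. j < glength gs \<Longrightarrow> p + j < length (code Q) \<and> code Q ! (p + j) = compile p gs ! j"
    and "\<forall>i\<le>n. bounded_mem B (mem (run Q x i))"
  shows "\<exists>n' \<le> n + glength gs. pc (run Q x n') = p + glength gs \<and>
           out (run Q x n') = out (run Q x n) \<and>
           \<Phi> (mem (run Q x n')) (used_cells Q x n') \<and>
           (\<forall>i\<le>n'. bounded_mem B (mem (run Q x i)))"
  using assms
proof (induction gs arbitrary: n p)
  case Nil
  then show ?case by auto
next
  case (Cons g gs)
  let ?s = "run Q x n"
  show ?case
  proof (cases g)
    case (Plain i)
    have c: "p < length (code Q)" "code Q ! p = i"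
      using Cons.prems(3)[of 0] Plain by auto
    have st: "straight i" "bounded_mem B (effect x i (mem ?s))"
      and w: "wp x B gs \<Phi> (effect x i (mem ?s)) (used_cells Q x n \<union> touched (mem ?s) i)"
      using Cons.prems(1) Plain by auto
    have nh: "\<not> halted Q ?s" using c Cons.prems(2) by (simp add: halted_def)
    have s1: "run Q x (Suc n) = ?s\<lparr>pc := Suc p, mem := effect x i (mem ?s)\<rparr>"
      using nh c st Cons.prems(2) by (simp add: run_Suc step_def exec_straight)
    have u1: "used_cells Q x (Suc n) = used_cells Q x n \<union> touched (mem ?s) i"
      using nh c Cons.prems(2) by (simp add: used_cells_Suc)
    have "\<exists>n' \<le> Suc n + glength gs. pc (run Q x n') = Suc p + glength gs \<and>
           out (run Q x n') = out (run Q x (Suc n)) \<and>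
           \<Phi> (mem (run Q x n')) (used_cells Q x n') \<and>
           (\<forall>i\<le>n'. bounded_mem B (mem (run Q x i)))"
    proof (rule Cons.IH)
      show "wp x B gs \<Phi> (mem (run Q x (Suc n))) (used_cells Q x (Suc n))"
        using w by (simp add: s1 u1)
      show "pc (run Q x (Suc n)) = Suc p" by (simp add: s1)
      show "Suc p + j < length (code Q) \<and> code Q ! (Suc p + j) = compile (Suc p) gs ! j"
        if "j < glength gs" for j
        using Cons.prems(3)[of "Suc j"] that Plain by simp
      show "\<forall>i\<le>Suc n. bounded_mem B (mem (run Q x i))"
        using Cons.prems(4) st by (auto simp: le_Suc_eq s1)
    qed
    then show ?thesis using Plain by (auto simp: s1)
  next
    case (Guarded r i)
    have c: "p < length (code Q)" "code Q ! p = JZero r (p + 2)"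
      "Suc p < length (code Q)" "code Q ! Suc p = i"
      using Cons.prems(3)[of 0] Cons.prems(3)[of 1] Guarded by auto
    have nh: "\<not> halted Q ?s" using c Cons.prems(2) by (simp add: halted_def)
    have s1: "run Q x (Suc n) = ?s\<lparr>pc := (if mem ?s (Reg r) = 0 then p + 2 else Suc p)\<rparr>"
      using nh c Cons.prems(2) by (simp add: run_Suc step_def)
    have u1: "used_cells Q x (Suc n) = insert (Reg r) (used_cells Q x n)"
      using nh c Cons.prems(2) by (simp add: used_cells_Suc)
    have code: "p + 2 + j < length (code Q) \<and> code Q ! (p + 2 + j) = compile (p + 2) gs ! j"
      if "j < glength gs" for j
      using Cons.prems(3)[of "Suc (Suc j)"] that Guarded by simp
    have bd1: "\<forall>i\<le>Suc n. bounded_mem B (mem (run Q x i))"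
      using Cons.prems(4) by (auto simp: le_Suc_eq s1)
    show ?thesis
    proof (cases "mem ?s (Reg r) = 0")
      case True
      have "\<exists>n' \<le> Suc n + glength gs. pc (run Q x n') = p + 2 + glength gs \<and>
           out (run Q x n') = out (run Q x (Suc n)) \<and>
           \<Phi> (mem (run Q x n')) (used_cells Q x n') \<and>
           (\<forall>i\<le>n'. bounded_mem B (mem (run Q x i)))"
        using Cons.prems(1) True Guarded code bd1 by (intro Cons.IH) (auto simp: s1 u1)
      then obtain n' where "n' \<le> Suc n + glength gs" "pc (run Q x n') = p + 2 + glength gs"
           "out (run Q x n') = out (run Q x (Suc n))"
           "\<Phi> (mem (run Q x n')) (used_cells Q x n')"
           "\<forall>i\<le>n'. bounded_mem B (mem (run Q x i))" by blast
      then show ?thesis using Guarded by (intro exI[of _ n']) (auto simp: s1)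
    next
      case False
      let ?m = "effect x i (mem ?s)"
      have st: "straight i" "bounded_mem B ?m"
        and w: "wp x B gs \<Phi> ?m (insert (Reg r) (used_cells Q x n) \<union> touched (mem ?s) i)"
        using Cons.prems(1) Guarded False by auto
      have nh1: "\<not> halted Q (run Q x (Suc n))" using c False by (simp add: halted_def s1)
      have s2: "run Q x (Suc (Suc n)) = ?s\<lparr>pc := p + 2, mem := ?m\<rparr>"
        using nh1 c False st by (simp add: run_Suc[of _ _ "Suc n"] step_def s1 exec_straight)
      have u2: "used_cells Q x (Suc (Suc n)) =
          insert (Reg r) (used_cells Q x n) \<union> touched (mem ?s) i"
        using nh1 c False by (simp add: used_cells_Suc[of _ _ "Suc n"] s1 u1)
      have "\<exists>n' \<le> Suc (Suc n) + glength gs. pc (run Q x n') = p + 2 + glength gs \<and>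
           out (run Q x n') = out (run Q x (Suc (Suc n))) \<and>
           \<Phi> (mem (run Q x n')) (used_cells Q x n') \<and>
           (\<forall>i\<le>n'. bounded_mem B (mem (run Q x i)))"
        using w code bd1 st by (intro Cons.IH) (auto simp: s2 u2 le_Suc_eq)
      then show ?thesis using Guarded by (auto simp: s2)
    qed
  qed
qed

section \<open>Forests of digit strings\<close>

fun walk :: "(nat \<Rightarrow> nat \<Rightarrow> nat) \<Rightarrow> nat \<Rightarrow> nat list \<Rightarrow> nat" where
  "walk f v [] = v"
| "walk f v (d # ds) = walk f (f v d) ds"

lemma walk_append [simp]: "walk f v (ds @ es) = walk f (walk f v ds) es"
  by (induction ds arbitrary: v) auto

text \<open>
  \<open>f v e\<close> is the \<open>e\<close>-th child of node \<open>v\<close>, with 0 for a missing child.  The nodes are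
  \<open>1, \<dots>, n\<close>, of which \<open>1, \<dots>, A\<close> are roots.
\<close>
definition forest :: "nat \<Rightarrow> (nat \<Rightarrow> nat \<Rightarrow> nat) \<Rightarrow> nat \<Rightarrow> bool" where
  "forest A f n \<longleftrightarrow> A \<le> n \<and>
     (\<forall>v e. f v e \<noteq> 0 \<longrightarrow> A < f v e \<and> f v e \<le> n \<and> 0 < v \<and> v \<le> n) \<and>
     (\<forall>v e v' e'. f v e = f v' e' \<longrightarrow> f v e \<noteq> 0 \<longrightarrow> v = v' \<and> e = e')"

lemma forest_child:
  assumes "forest A f n" "f v e \<noteq> 0"
  shows "A < f v e" "f v e \<le> n" "0 < v" "v \<le> n"
  using assms unfolding forest_def by blast+

lemma forest_inj: "forest A f n \<Longrightarrow> f v e = f v' e' \<Longrightarrow> f v e \<noteq> 0 \<Longrightarrow> v = v' \<and> e = e'"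
  unfolding forest_def by blast

lemma forest_root: "forest A f n \<Longrightarrow> a < A \<Longrightarrow> f v e \<noteq> Suc a"
  using forest_child(1)[of A f n v e] by linarith

lemma forest_le: "forest A f n \<Longrightarrow> f v e \<le> n"
  using forest_child(2)[of A f n v e] by linarith

lemma forest_0: "forest A f n \<Longrightarrow> f 0 e = 0"
  using forest_child(3)[of A f n 0 e] by blast

lemma forest_gt: "forest A f n \<Longrightarrow> n < v \<Longrightarrow> f v e = 0"
  using forest_child(4)[of A f n v e] by linarith

lemma walk_0: "forest A f n \<Longrightarrow> walk f 0 ds = 0"
  by (induction ds) (simp_all add: forest_0[of A f n])

lemma walk_le: "forest A f n \<Longrightarrow> v \<le> n \<Longrightarrow> walk f v ds \<le> n"
  by (induction ds arbitrary: v) (simp_all add: forest_le[of A f n])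

text \<open>A non-root node determines its parent and the last digit, so digits are peeled off from
  the end. Strings of different lengths are excluded because a root is nobody's child.\<close>

lemma walk_inj:
  assumes "forest A f n" "a < A" "a' < A"
    and "walk f (Suc a) ds = walk f (Suc a') ds'" "walk f (Suc a) ds \<noteq> 0"
  shows "a = a' \<and> ds = ds'"
  using assms(4,5)
proof (induction ds arbitrary: ds' rule: rev_induct)
  case Nil
  show ?case
  proof (cases ds' rule: rev_cases)
    case (snoc es e)
    with Nil have "f (walk f (Suc a') es) e = Suc a" by simp
    then show ?thesis using forest_root[OF assms(1,2)] by blast
  qed (use Nil in auto)
next
  case (snoc e es)
  have *: "f (walk f (Suc a) es) e = walk f (Suc a') ds'" "f (walk f (Suc a) es) e \<noteq> 0"
    using snoc.prems by simp_all
  show ?case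
  proof (cases ds' rule: rev_cases)
    case Nil
    then show ?thesis using forest_root[OF assms(1,3)] *(1) by simp
  next
    case ds': (snoc es' e')
    then have "walk f (Suc a) es = walk f (Suc a') es' \<and> e = e'"
      using * by (intro forest_inj[OF assms(1)]) simp_all
    moreover have "walk f (Suc a) es \<noteq> 0"
      using forest_child(3)[OF assms(1) *(2)] by blast
    ultimately show ?thesis using snoc.IH[of es'] ds' by simp
  qed
qed

lemma forest_extend:
  assumes "forest A f n" "f v e = 0" "0 < v" "v \<le> n"
  shows "forest A (f(v := (f v)(e := Suc n))) (Suc n)"
proof -
  let ?g = "f(v := (f v)(e := Suc n))"
  have g: "?g w d = (if w = v \<and> d = e then Suc n else f w d)" for w d by simp
  have old: "f w d \<noteq> Suc n" for w d using forest_le[OF assms(1), of w d] by simp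
  have "A \<le> n" using assms(1) by (simp add: forest_def)
  moreover have "A < ?g w d \<and> ?g w d \<le> Suc n \<and> 0 < w \<and> w \<le> Suc n" if "?g w d \<noteq> 0" for w d
    using that assms(3,4) \<open>A \<le> n\<close> forest_child[OF assms(1), of w d]
    unfolding g by (cases "w = v \<and> d = e") auto
  moreover have "w = w' \<and> d = d'" if "?g w d = ?g w' d'" "?g w d \<noteq> 0" for w d w' d'
    using that old[of w d] old[of w' d'] forest_inj[OF assms(1), of w d w' d']
    unfolding g by (auto split: if_splits)
  ultimately show ?thesis unfolding forest_def by (metis le_SucI)
qed

text \<open>The fresh node is a leaf: only walks that failed before can change, and the changed ones
  end exactly there. Since index 0 and the fresh index both carry content 0, the represented arrays
  will not notice.\<close>

lemma walk_extend:
  assumes "forest A f n" "f v e = 0" "0 < v" "v \<le> n" "w \<le> n"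
  defines "f' \<equiv> f(v := (f v)(e := Suc n))"
  shows "walk f' w ds = walk f w ds \<or> walk f w ds = 0 \<and> walk f' w ds = Suc n"
  using \<open>w \<le> n\<close>
proof (induction ds arbitrary: w)
  case (Cons d ds)
  have f': "forest A f' (Suc n)" unfolding f'_def by (rule forest_extend) fact+
  show ?case
  proof (cases "w = v \<and> d = e")
    case True
    have 1: "walk f w (d # ds) = 0" using True assms(2) walk_0[OF assms(1)] by simp
    have "walk f' (Suc n) ds \<in> {0, Suc n}"
    proof (cases ds)
      case (Cons e' es)
      have "f' (Suc n) e' = 0"
        using assms(4) forest_gt[OF assms(1)] by (simp add: f'_def)
      then show ?thesis using Cons walk_0[OF f'] by simp
    qed simp
    moreover have "f' w d = Suc n" using True by (simp add: f'_def)
    ultimately have "walk f' w (d # ds) \<in> {0, Suc n}" by simp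
    then show ?thesis using 1 by auto
  next
    case False
    then have "f' w d = f w d" by (auto simp: f'_def)
    then show ?thesis using Cons.IH[of "f w d"] forest_le[OF assms(1)] by simp
  qed
qed simp

text \<open>Digits come least significant first, with fixed width \<open>L\<close> per index. The
  product matches the pairs of index register and digit position that \<open>access\<close> runs
  through.\<close>

definition digits :: "nat \<Rightarrow> nat \<Rightarrow> nat list \<Rightarrow> nat list" where
  "digits b L ns = map (\<lambda>(n, l). n div b ^ l mod b) (List.product ns [0..<L])"

lemma digits_Cons: "digits b L (n # ns) = map (\<lambda>l. n div b ^ l mod b) [0..<L] @ digits b L ns"
  by (simp add: digits_def comp_def)

lemma length_digits [simp]: "length (digits b L ns) = length ns * L"
  by (simp add: digits_def)

lemma digits_eq_imp_eq:
  fixes n m b :: nat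
  assumes "\<And>l. l < L \<Longrightarrow> n div b ^ l mod b = m div b ^ l mod b" "n < b ^ L" "m < b ^ L"
  shows "n = m"
  using assms
proof (induction L arbitrary: n m)
  case (Suc L)
  have b: "b > 0" using Suc.prems(2) by (cases b) auto
  have "n div b = m div b"
  proof (rule Suc.IH)
    show "n div b div b ^ l mod b = m div b div b ^ l mod b" if "l < L" for l
      using Suc.prems(1)[of "Suc l"] that by (simp add: div_mult2_eq)
    show "n div b < b ^ L" "m div b < b ^ L"
      using Suc.prems b by (simp_all add: less_mult_imp_div_less mult.commute)
  qed
  moreover have "n mod b = m mod b" using Suc.prems(1)[of 0] by simp
  ultimately show ?case by (metis div_mult_mod_eq)
qed auto

text \<open>Fixed width makes the concatenation uniquely decodable; \<open>0 < L\<close> lets the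
  length of the string determine the number of indices.\<close>

lemma digits_inj:
  assumes "digits b L ns = digits b L ms" "0 < L"
    and "\<forall>n\<in>set ns. n < b ^ L" "\<forall>m\<in>set ms. m < b ^ L"
  shows "ns = ms"
  using assms
proof (induction ns arbitrary: ms)
  case Nil
  then have "length (digits b L ms) = 0" by (metis length_0_conv length_digits mult_0 list.size(3))
  then show ?case using Nil by simp
next
  case (Cons n ns)
  have "length (digits b L ms) = length (n # ns) * L" by (metis Cons.prems(1) length_digits)
  then obtain m ms' where ms: "ms = m # ms'" using \<open>0 < L\<close> by (cases ms) auto
  have *: "map (\<lambda>l. n div b ^ l mod b) [0..<L] = map (\<lambda>l. m div b ^ l mod b) [0..<L]"
    "digits b L ns = digits b L ms'"
    using Cons.prems(1) by (simp_all add: ms digits_Cons)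
  have "n div b ^ l mod b = m div b ^ l mod b" if "l < L" for l
    using * that by (auto simp: map_eq_conv)
  then have "n = m" using Cons.prems by (intro digits_eq_imp_eq[of L n b m]) (auto simp: ms)
  moreover have "ns = ms'" using Cons.IH * Cons.prems by (simp add: ms)
  ultimately show ?case by (simp add: ms)
qed

section \<open>The simulating program\<close>

text \<open>
  An index has \<open>L\<close> digits.  On inputs longer than \<open>n1\<close>, \<open>c\<close> nodes share a row of the
  two-dimensional array; on shorter ones, \<open>K0\<close> is the base.
\<close>
locale sim_code =
  fixes P :: ram and d L c K0 n1 :: nat
begin

abbreviation A :: nat where "A \<equiv> length (dims P)"

text \<open>
  Register usage: 0 current node, 14 number of allocated non-root nodes, 2 nonzero iff the input
  is longer than \<open>n1\<close>, 3 the base, 6 current digit, 7 and 8 row and column in the two-dimensional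
  array, 9 index in the one-dimensional child table, 10 child found, 13 whether it was missing;
  4, 5, 11 and 12 hold constants.  Register \<open>i\<close> of \<open>P\<close> is kept in register \<open>i + 15\<close>.
\<close>
definition prologue :: "nat \<Rightarrow> gins list" where
  "prologue a =
    [Plain (Const 4 c), Plain (Const 5 K0), Plain (Const 3 K0), Plain (Const 11 1),
     Plain (Const 12 A), Plain (Size 2), Plain (Const 13 n1), Plain (Arith Sub 2 2 13),
     Guarded 2 (Size 3), Guarded 2 (Root d 3 3), Guarded 2 (Arith Div 3 3 4),
     Plain (Const 0 (Suc a))]"

text \<open>
  On long inputs array 1 is also written, with clashing indices, but what is read from it is
  overwritten by the entry of array 0.
\<close>
fun child_step :: "nat \<times> nat \<Rightarrow> gins list" where
  "child_step (j, l) =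
    [Plain (Digit 6 l (j + 15) 3),
     Plain (Arith Mul 9 0 5), Plain (Arith Add 9 9 6),
     Plain (Arith Div 7 0 4),
     Plain (Arith Mod 8 0 4), Plain (Arith Mul 8 8 3), Plain (Arith Add 8 8 6),
     Plain (ALoad 10 1 [9]), Guarded 2 (ALoad 10 0 [7, 8]),
     Plain (Arith Sub 13 11 10), Plain (Arith Add 14 14 13),
     Plain (Arith Add 1 14 12), Plain (Arith Mul 1 1 13), Plain (Arith Add 0 10 1),
     Plain (AStore 1 [9] 0), Guarded 2 (AStore 0 [7, 8] 0)]"

definition access :: "nat \<Rightarrow> nat list \<Rightarrow> gins list" where
  "access a js = prologue a @ concat (map child_step (List.product js [0..<L]))"

text \<open>Puts into register 0 the address that \<open>final\<close> will use: a node for array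
  accesses, and for indirect addressing the register number shifted by 15, which can only be
  computed at run time.\<close>

fun prep :: "instr \<Rightarrow> gins list" where
  "prep (Load i j) = [Plain (Const 0 15), Plain (Arith Add 0 0 (j + 15))]"
| "prep (Store i j) = [Plain (Const 0 15), Plain (Arith Add 0 0 (i + 15))]"
| "prep (ALoad i a js) = access a js"
| "prep (AStore a js i) = access a js"
| "prep _ = []"

text \<open>All blocks have length \<open>K\<close>, so a jump to \<open>l\<close> becomes a jump to \<open>l * K\<close>.\<close>
definition K :: nat where
  "K = Suc (sum_list (map (glength \<circ> prep) (code P)))"

text \<open>A single instruction carries out the visible effect, so all code before it merely has to
  preserve the represented state. Jumps behind the end of \<open>P\<close> stay behind the end of
  the simulating program.\<close>

fun final :: "instr \<Rightarrow> instr" where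
  "final (Const i n) = Const (i + 15) n"
| "final (Size i) = Size (i + 15)"
| "final (Input i j) = Input (i + 15) (j + 15)"
| "final (Arith f i j l) = Arith f (i + 15) (j + 15) (l + 15)"
| "final (Root r i j) = Root r (i + 15) (j + 15)"
| "final (Digit i l j b) = Digit (i + 15) l (j + 15) (b + 15)"
| "final (Load i j) = Load (i + 15) 0"
| "final (Store i j) = Store 0 (j + 15)"
| "final (ALoad i a js) = ALoad (i + 15) 2 [0]"
| "final (AStore a js i) = AStore 2 [0] (i + 15)"
| "final (JZero i l) = JZero (i + 15) (l * K)"
| "final (Output i) = Output (i + 15)"
| "final Halt = Halt"

text \<open>The filler stands between \<open>prep\<close> and \<open>final\<close>, so it may write
  to a scratch register but not to register 0.\<close>

definition padded :: "instr \<Rightarrow> gins list" where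
  "padded i = prep i @ replicate (K - 1 - glength (prep i)) (Plain (Const 6 0))"

definition block :: "nat \<Rightarrow> instr list" where
  "block p = compile (p * K) (padded (code P ! p)) @ [final (code P ! p)]"

text \<open>Array 0 is the packed child table, array 1 its substitute for short inputs, array 2
  holds the node contents.\<close>

definition Q :: ram where
  "Q = \<lparr>dims = [2, 1, 1],
        code = map (\<lambda>q. block (q div K) ! (q mod K)) [0..<length (code P) * K]\<rparr>"

lemma K_pos: "0 < K" by (simp add: K_def)

lemma glength_padded:
  assumes "p < length (code P)"
  shows "glength (padded (code P ! p)) = K - 1"
proof -
  have "glength (prep (code P ! p)) \<le> sum_list (map (glength \<circ> prep) (code P))"
    using assms by (intro member_le_sum_list) auto
  then show ?thesis by (simp add: padded_def K_def)
qed

lemma length_block: "p < length (code P) \<Longrightarrow> length (block p) = K"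
  using K_pos by (simp add: block_def glength_padded)

lemma length_code_Q: "length (code Q) = length (code P) * K"
  by (simp add: Q_def)

lemma code_Q:
  assumes "p < length (code P)" "j < K"
  shows "p * K + j < length (code Q)" "code Q ! (p * K + j) = block p ! j"
proof -
  have "p * K + j < Suc p * K" using assms by simp
  also have "\<dots> \<le> length (code P) * K" using assms by (intro mult_le_mono1) auto
  finally show 1: "p * K + j < length (code Q)" by (simp add: length_code_Q)
  then show "code Q ! (p * K + j) = block p ! j"
    using assms by (simp add: Q_def)
qed

lemma wf_compile:
  "\<forall>g\<in>set gs. case g of Plain i \<Rightarrow> wf_instr ds i | Guarded r i \<Rightarrow> wf_instr ds i \<Longrightarrow>
   \<forall>i\<in>set (compile p gs). wf_instr ds i"
  by (induction p gs rule: compile.induct) auto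

lemma wf_Q:
  assumes "wf_ram P" "1 \<le> d"
  shows "wf_ram Q"
proof -
  have prep: "case g of Plain i \<Rightarrow> wf_instr [2,1,1] i | Guarded r i \<Rightarrow> wf_instr [2,1,1] i"
    if "g \<in> set (prep i)" for g i
    using that \<open>1 \<le> d\<close>
    by (cases i) (auto simp: access_def prologue_def)
  have final: "wf_instr [2,1,1] (final i)" if "wf_instr (dims P) i" for i
    using that by (cases i) auto
  have "wf_instr [2,1,1] i" if i: "i \<in> set (code Q)" for i
  proof -
    obtain q where q: "q < length (code P) * K" "i = block (q div K) ! (q mod K)"
      using i by (auto simp: Q_def)
    have p: "q div K < length (code P)" using q(1) by (simp add: less_mult_imp_div_less)
    have "i \<in> set (block (q div K))"
      using q p K_pos by (auto simp: length_block intro!: nth_mem)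
    moreover have "wf_instr (dims P) (code P ! (q div K))"
      using assms(1) p by (auto simp: wf_ram_def)
    moreover have "\<forall>i\<in>set (compile p (padded i')). wf_instr [2,1,1] i" for p i'
      by (rule wf_compile) (auto simp: padded_def prep)
    ultimately show ?thesis using final by (auto simp: block_def)
  qed
  then show ?thesis by (simp add: wf_ram_def Q_def)
qed

end

section \<open>The simulation invariant\<close>

lemma nth_root_nat_le: "1 \<le> d \<Longrightarrow> nth_root_nat d n \<le> n"
proof -
  assume "1 \<le> d"
  then have "nth_root_nat d n ^ d \<le> n" by (intro nth_root_nat_power_le) auto
  moreover have "nth_root_nat d n \<le> nth_root_nat d n ^ d"
    using \<open>1 \<le> d\<close> by (cases "nth_root_nat d n = 0") (auto intro: self_le_power)
  ultimately show ?thesis by linarith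
qed

text \<open>One fixed input. \<open>W\<close> stands for the cells that \<open>P\<close> ever uses
  on it, \<open>V\<close> for the bound on its values, and \<open>M\<close> bounds the non-root
  nodes, since a key has at most \<open>Suc (k * L)\<close> prefixes.\<close>

locale sim_run = sim_code P d L c K0 n1
  for P :: ram and d L c K0 n1 :: nat +
  fixes x :: "nat list" and k V M :: nat and W :: "cell set"
  assumes d: "1 \<le> d" and L: "1 \<le> L" and c: "1 \<le> c"
    and W: "finite W" "card W * Suc (k * L) \<le> M"
    and W_entry: "\<And>a ns. Entry a ns \<in> W \<Longrightarrow> a < A \<and> length ns \<le> k"
    and long_input: "n1 < length x \<Longrightarrow>
      A + M < c * length x \<and> V < (nth_root_nat d (length x) div c) ^ L"
    and short_input: "length x \<le> n1 \<Longrightarrow> V < K0"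
begin

abbreviation N :: nat where "N \<equiv> length x"

definition base :: nat where
  "base = (if n1 < N then nth_root_nat d N div c else K0)"

definition slot :: "nat \<Rightarrow> nat \<Rightarrow> cell" where
  "slot v e = (if n1 < N then Entry 0 [v div c, v mod c * base + e] else Entry 1 [v * K0 + e])"

text \<open>Digits from \<open>base\<close> on are cut off because \<open>slot\<close> would let
  them run into the slots of other nodes.\<close>

definition child :: "memory \<Rightarrow> nat \<Rightarrow> nat \<Rightarrow> nat" where
  "child m v e = (if e < base then m (slot v e) else 0)"

definition edges :: "memory \<Rightarrow> cell set" where
  "edges m = {slot v e | v e. child m v e \<noteq> 0}"

abbreviation key :: "nat list \<Rightarrow> nat list" where
  "key \<equiv> digits base L"

definition paths :: "(nat \<times> nat list) set" where
  "paths = {(a, take i (key ns)) | a ns i. Entry a ns \<in> W}"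

text \<open>The product dominates node numbers and the indices \<open>v * K0 + e\<close> of array 1;
  the summands cover root, base, values of \<open>P\<close>, loaded constants and the address shift
  by 15. With constant \<open>A\<close>, \<open>K0\<close>, \<open>c\<close>, \<open>n1\<close> it
  is linear in \<open>M\<close>, \<open>V\<close> and \<open>N\<close>.\<close>

definition B :: nat where
  "B = (A + M + 2) * (K0 + 2) + 2 * N + V + c + n1 + 15"

text \<open>Array 1 is charged with its whole index range, because on long inputs it is touched at
  clashing, meaningless indices.\<close>

definition static :: "cell set" where
  "static = Reg ` {..<15} \<union> {Reg (i + 15) | i. Reg i \<in> W} \<union>
     (\<lambda>i. Entry 1 [i]) ` {..B} \<union> (\<lambda>i. Entry 2 [i]) ` {..A + M}"

text \<open>\<open>p\<close> is the memory of \<open>P\<close>, \<open>m\<close> the simulating one,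
  \<open>u\<close> the cells touched so far. Content 0 at index 0 and beyond the counter makes
  missing and fresh nodes represent untouched cells; the clause on \<open>paths\<close> bounds the
  counter. Indices are limited to \<open>V\<close> because \<open>L\<close> digits determine only
  numbers below \<open>base ^ L\<close>.\<close>

definition inv :: "memory \<Rightarrow> memory \<Rightarrow> cell set \<Rightarrow> bool" where
  "inv p m u \<longleftrightarrow>
     bounded_mem B m \<and>
     forest A (child m) (A + m (Reg 14)) \<and>
     (\<forall>v. v = 0 \<or> A + m (Reg 14) < v \<longrightarrow> m (Entry 2 [v]) = 0) \<and>
     (\<forall>v. A < v \<longrightarrow> v \<le> A + m (Reg 14) \<longrightarrow>
        (\<exists>(a, ds) \<in> paths. walk (child m) (Suc a) ds = v)) \<and>
     u \<subseteq> static \<union> edges m \<and>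
     (\<forall>i. p (Reg i) = m (Reg (i + 15))) \<and>
     (\<forall>a ns. a < A \<longrightarrow> (\<forall>n\<in>set ns. n \<le> V) \<longrightarrow>
        p (Entry a ns) = m (Entry 2 [walk (child m) (Suc a) (key ns)]))"

definition ready :: "memory \<Rightarrow> bool" where
  "ready m \<longleftrightarrow> (m (Reg 2) \<noteq> 0 \<longleftrightarrow> n1 < N) \<and> m (Reg 3) = base \<and> m (Reg 4) = c \<and>
     m (Reg 5) = K0 \<and> m (Reg 11) = 1 \<and> m (Reg 12) = A"

lemma base: "V < base ^ L" "0 < base" "base \<le> K0 + N"
proof -
  show *: "V < base ^ L"
  proof (cases "n1 < N")
    case False
    moreover have "K0 \<le> K0 ^ L" using L short_input False
      by (intro self_le_power) auto
    ultimately show ?thesis using short_input by (simp add: base_def)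
  qed (use long_input in \<open>simp add: base_def\<close>)
  show "0 < base" using * L by (cases base) (auto simp: zero_power)
  have "nth_root_nat d N div c \<le> N" using nth_root_nat_le[OF d] div_le_dividend le_trans by blast
  then show "base \<le> K0 + N" by (simp add: base_def)
qed

lemma base_long: "n1 < N \<Longrightarrow> c * base \<le> nth_root_nat d N"
  by (simp add: base_def mult.commute)

lemma slot_inj:
  assumes "slot v e = slot v' e'" "e < base" "e' < base"
  shows "v = v' \<and> e = e'"
proof -
  have *: "q = q' \<and> r = r'" if "q * b + r = q' * b + r'" "r < b" "r' < b" for q r q' r' b :: nat
  proof -
    have "(q * b + r) div b = q" "(q' * b + r') div b = q'" using that(2,3) by auto
    then show ?thesis using that(1) by auto
  qed
  show ?thesis
  proof (cases "n1 < N")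
    case True
    then have "v div c = v' div c" "v mod c * base + e = v' mod c * base + e'"
      using assms(1) by (simp_all add: slot_def)
    then show ?thesis using *[of "v mod c" base e "v' mod c" e'] assms(2,3)
      by (metis div_mult_mod_eq)
  next
    case False
    then show ?thesis using assms *[of v base e v' e'] by (simp add: slot_def base_def)
  qed
qed

lemma slot_neq [simp]: "slot v e \<noteq> Reg i" "slot v e \<noteq> Entry 2 t"
  by (simp_all add: slot_def)

text \<open>Keys of cells in \<open>W\<close> have at most \<open>k * L\<close> digits, so pairs of
  a cell and a prefix length up to \<open>k * L\<close> cover all paths.\<close>

lemma finite_paths: "finite paths" and card_paths: "card paths \<le> M"
proof -
  let ?f = "\<lambda>(q, i). case q of Entry a ns \<Rightarrow> (a, take i (key ns)) | _ \<Rightarrow> (0, [])"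
  have sub: "paths \<subseteq> ?f ` (W \<times> {..k * L})"
  proof
    fix z assume "z \<in> paths"
    then obtain a ns i where z: "z = (a, take i (key ns))" "Entry a ns \<in> W"
      unfolding paths_def by blast
    have len: "length ns * L \<le> k * L" using W_entry[OF z(2)] by (intro mult_le_mono1) simp
    have "take i (key ns) = take (min i (k * L)) (key ns)"
      using len le_trans[OF len, of i] by (auto simp: min_def)
    then have "z = ?f (Entry a ns, min i (k * L))" by (simp add: z(1))
    then show "z \<in> ?f ` (W \<times> {..k * L})" using z(2) by (elim image_eqI) simp
  qed
  then show "finite paths" using W(1) by (intro finite_subset[OF sub]) simp
  have "card paths \<le> card (W \<times> {..k * L})"
    using W(1) by (intro surj_card_le[OF _ sub]) simp
  then show "card paths \<le> M" using W(2) by (simp add: card_cartesian_product)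
qed

text \<open>Walking maps \<open>paths\<close> onto a set containing all non-root nodes. Here the
  space used by \<open>P\<close> limits the size of the forest.\<close>

lemma allocated_le:
  assumes "inv p m u"
  shows "m (Reg 14) \<le> M"
proof -
  have "{A<..A + m (Reg 14)} \<subseteq> (\<lambda>(a, ds). walk (child m) (Suc a) ds) ` paths"
    using assms unfolding inv_def by fastforce
  then have "card {A<..A + m (Reg 14)} \<le> card paths"
    using finite_paths by (rule surj_card_le[rotated])
  then show ?thesis using card_paths by simp
qed

text \<open>The memory itself injects occupied slots into non-root nodes: a slot stores its child,
  and a child has only one parent slot.\<close>

lemma card_edges:
  assumes "inv p m u"
  shows "finite (edges m)" "card (edges m) \<le> M"
proof -
  have f: "forest A (child m) (A + m (Reg 14))" using assms by (simp add: inv_def)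
  have val: "m (slot v e) = child m v e" if "child m v e \<noteq> 0" for v e
    using that by (auto simp: child_def)
  have inj: "inj_on m (edges m)"
  proof (rule inj_onI)
    fix s s' assume "s \<in> edges m" "s' \<in> edges m" "m s = m s'"
    then obtain v e v' e' where *: "s = slot v e" "s' = slot v' e'" "child m v e \<noteq> 0"
      "child m v' e' \<noteq> 0" by (auto simp: edges_def)
    with \<open>m s = m s'\<close> have "child m v e = child m v' e'" by (simp add: val)
    then show "s = s'" using forest_inj[OF f] * by blast
  qed
  have im: "m ` edges m \<subseteq> {A<..A + m (Reg 14)}"
  proof
    fix y assume "y \<in> m ` edges m"
    then obtain v e where "y = child m v e" "child m v e \<noteq> 0" by (auto simp: edges_def val)
    then show "y \<in> {A<..A + m (Reg 14)}" using forest_child[OF f] by simp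
  qed
  then show "finite (edges m)" using inj by (meson finite_greaterThanAtMost finite_imageD finite_subset)
  have "card (edges m) = card (m ` edges m)" using inj by (simp add: card_image)
  also have "\<dots> \<le> card {A<..A + m (Reg 14)}" using im by (intro card_mono) auto
  finally show "card (edges m) \<le> M" using allocated_le[OF assms] by simp
qed

text \<open>Pairs of indices occur only in occupied slots on long inputs. The row bound comes from
  \<open>A + M < c * N\<close>, the column bound from \<open>c\<close> groups of \<open>base\<close>
  columns fitting below the root.\<close>

lemma edges_within_bounds:
  assumes "inv p m u" "Entry a [i, j] \<in> u"
  shows "i < N \<and> j < nth_root_nat d N"
proof -
  have f: "forest A (child m) (A + m (Reg 14))" using assms by (simp add: inv_def)
  have "Entry a [i, j] \<in> edges m"
    using assms unfolding inv_def static_def by auto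
  then obtain v e where *: "Entry a [i, j] = slot v e" "child m v e \<noteq> 0"
    by (auto simp: edges_def)
  have e: "e < base" using *(2) by (auto simp: child_def split: if_splits)
  have long: "n1 < N" using *(1) by (auto simp: slot_def split: if_splits)
  then have ij: "i = v div c" "j = v mod c * base + e" using *(1) by (auto simp: slot_def)
  have "v \<le> A + M" using forest_child(4)[OF f *(2)] allocated_le[OF assms(1)] by linarith
  then have "v < N * c" using long_input long by (simp add: mult.commute)
  then have "i < N" unfolding ij by (rule less_mult_imp_div_less)
  have "j < Suc (v mod c) * base" using e by (simp add: ij)
  also have "\<dots> \<le> c * base" using c by (intro mult_le_mono1) (simp add: Suc_leI)
  finally show ?thesis using \<open>i < N\<close> base_long[OF long] by linarith
qed

text \<open>Registers below 15 other than the node counter are scratch space for the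
  invariant.\<close>

lemma inv_cong:
  assumes "inv p m u" "bounded_mem B m'" "m' (Reg 14) = m (Reg 14)"
    and "\<And>i. m' (Reg (i + 15)) = m (Reg (i + 15))"
    and "\<And>a t. m' (Entry a t) = m (Entry a t)" "u' \<subseteq> u \<union> static"
  shows "inv p m' u'"
proof -
  have ch: "child m' = child m"
    using assms(5) by (intro ext) (simp add: child_def slot_def)
  then have "edges m' = edges m" by (simp add: edges_def)
  then show ?thesis using assms unfolding inv_def ch by auto
qed

text \<open>Following an edge and creating a leaf are treated together, as the program stores
  \<open>w\<close> in both cases; for an existing child this changes nothing. Storing a nonzero
  value turns the touched slot into an occupied one, which keeps \<open>u'\<close> accounted
  for.\<close>

lemma inv_child_step:
  assumes "inv p m u" "e < base" "v = walk (child m) (Suc a) ds" "0 < v" "a < A"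
    and "(a, ds @ [e]) \<in> paths"
    and w: "w = (if m (slot v e) = 0 then Suc (A + m (Reg 14)) else m (slot v e))"
    and m': "bounded_mem B m'" "m' (Reg 14) = (if m (slot v e) = 0 then Suc (m (Reg 14)) else m (Reg 14))"
      "\<And>i. m' (Reg (i + 15)) = m (Reg (i + 15))"
      "\<And>t. m' (Entry 2 t) = m (Entry 2 t)" "m' (slot v e) = w"
      "\<And>v' e'. e' < base \<Longrightarrow> (v', e') \<noteq> (v, e) \<Longrightarrow> m' (slot v' e') = m (slot v' e')"
    and u': "u' \<subseteq> insert (slot v e) (u \<union> static)"
  shows "inv p m' u'" "walk (child m') (Suc a) (ds @ [e]) = w" "0 < w"
proof -
  let ?n = "A + m (Reg 14)"
  have f: "forest A (child m) ?n" using assms(1) by (simp add: inv_def)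
  have vn: "v \<le> ?n" unfolding assms(3) using assms(5) by (intro walk_le[OF f]) simp
  show "0 < w" using w by auto
  have cv: "child m v e = m (slot v e)" using \<open>e < base\<close> by (simp add: child_def)
  have ch: "child m' = (child m)(v := (child m v)(e := w))"
    using m'(5,6) \<open>e < base\<close> by (intro ext) (auto simp: child_def fun_upd_apply)
  have mono: "edges m \<subseteq> edges m'" "slot v e \<in> edges m'"
    using \<open>0 < w\<close> by (auto simp: edges_def ch)
  have wk: "walk (child m') (Suc a') es = walk (child m) (Suc a') es \<or>
      walk (child m) (Suc a') es = 0 \<and> walk (child m') (Suc a') es = Suc ?n \<and>
      m (slot v e) = 0" if "a' < A" for a' es
  proof (cases "m (slot v e) = 0")
    case True
    then show ?thesis
      using walk_extend[OF f, of v e "Suc a'" es] cv \<open>0 < v\<close> vn that by (simp add: ch w)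
  next
    case False
    then have "child m' = child m" by (simp add: ch w flip: cv)
    then show ?thesis by simp
  qed
  have "walk (child m') (Suc a) ds = v" using wk[OF \<open>a < A\<close>, of ds] assms(3,4) by simp
  then show new: "walk (child m') (Suc a) (ds @ [e]) = w" by (simp add: ch)
  have "forest A (child m') (A + m' (Reg 14))"
  proof (cases "m (slot v e) = 0")
    case True
    then show ?thesis
      using forest_extend[OF f, of v e] cv \<open>0 < v\<close> vn by (simp add: ch w m'(2))
  next
    case False
    then have "child m' = child m" by (simp add: ch w flip: cv)
    then show ?thesis using f False by (simp add: m'(2))
  qed
  moreover have "\<exists>(a, ds) \<in> paths. walk (child m') (Suc a) ds = y"
    if y: "A < y" "y \<le> A + m' (Reg 14)" for y
  proof (cases "y \<le> ?n")
    case True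
    then obtain a' es where *: "(a', es) \<in> paths" "walk (child m) (Suc a') es = y"
      using assms(1) y unfolding inv_def by blast
    then have "a' < A" using W_entry by (auto simp: paths_def)
    then show ?thesis using wk[of a' es] * y by auto
  next
    case False
    then have "y = w" using y m'(2) w by (auto split: if_splits)
    then show ?thesis using new by (intro bexI[OF _ assms(6)]) simp
  qed
  moreover have "p (Entry b ns) = m' (Entry 2 [walk (child m') (Suc b) (key ns)])"
    if "b < A" "\<forall>n\<in>set ns. n \<le> V" for b ns
  proof -
    have "p (Entry b ns) = m (Entry 2 [walk (child m) (Suc b) (key ns)])"
      using assms(1) that by (simp add: inv_def)
    also have "\<dots> = m (Entry 2 [walk (child m') (Suc b) (key ns)])"
    proof -
      \<comment> \<open>A walk changes at most from 0 to the fresh node, and both have content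
        0.\<close>
      have "m (Entry 2 [0]) = 0" "m (Entry 2 [Suc ?n]) = 0"
        using assms(1) by (simp_all add: inv_def)
      then show ?thesis using wk[OF that(1), of "key ns"] by auto
    qed
    finally show ?thesis by (simp add: m'(4))
  qed
  moreover have "m' (Entry 2 [y]) = 0" if "y = 0 \<or> A + m' (Reg 14) < y" for y
    using assms(1) that m'(2,4) unfolding inv_def by (auto split: if_splits)
  moreover have "u' \<subseteq> static \<union> edges m'"
    using u' mono assms(1) unfolding inv_def by blast
  ultimately show "inv p m' u'"
    using m'(1,3) assms(1) unfolding inv_def by auto
qed

section \<open>Correctness of the blocks\<close>

lemma B_bounds: "nth_root_nat d N \<le> B" "N \<le> B" "V \<le> B" "c \<le> B" "K0 \<le> B" "n1 \<le> B" "15 \<le> B"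
  "Suc (A + M) \<le> B" "base \<le> B"
proof -
  have "(A + M + 2) * 2 \<le> (A + M + 2) * (K0 + 2)" by (intro mult_le_mono2) simp
  moreover have "1 * (K0 + 2) \<le> (A + M + 2) * (K0 + 2)" by (intro mult_le_mono1) simp
  ultimately have *: "2 * (A + M + 2) \<le> B" "K0 + N \<le> B" by (auto simp: B_def)
  then show "Suc (A + M) \<le> B" "base \<le> B" using base(3) by simp_all
  show "nth_root_nat d N \<le> B" using nth_root_nat_le[OF d, of N] * by linarith
  show "N \<le> B" "V \<le> B" "c \<le> B" "K0 \<le> B" "n1 \<le> B" "15 \<le> B" using * by (simp_all add: B_def)
qed

lemma inv_bounded: "inv p m u \<Longrightarrow> bounded_mem B m"
  by (simp add: inv_def)

text \<open>The constants are recomputed at each access, so \<open>ready\<close> need not hold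
  between blocks.\<close>

lemma prologue_wp:
  assumes "inv p m u" "a < A"
  shows "wp x B (prologue a) (\<lambda>m u. inv p m u \<and> ready m \<and> m (Reg 0) = Suc a) m u"
proof -
  have le: "Suc a \<le> B" "A \<le> B" "N - n1 \<le> B" "nth_root_nat d N div c \<le> B" "Suc 0 \<le> B"
    using assms(2) B_bounds div_le_dividend[of "nth_root_nat d N" c] by linarith+
  note b = inv_bounded[OF assms(1)]
  show ?thesis
  proof (cases "n1 < N")
    case True
    then show ?thesis
      by (simp add: prologue_def bounded_mem_upd b le B_bounds ready_def base_def
          inv_cong[OF assms(1)] static_def)
  next
    case False
    then show ?thesis
      by (simp add: prologue_def bounded_mem_upd b le B_bounds ready_def base_def
          inv_cong[OF assms(1)] static_def)
  qed
qed

abbreviation digit :: "memory \<Rightarrow> nat \<times> nat \<Rightarrow> nat" where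
  "digit p jl \<equiv> p (Reg (fst jl)) div base ^ snd jl mod base"

text \<open>Creation is branch-free: by truncated subtraction register 13 is 1 if the child is
  missing and 0 otherwise; it is added to the counter and then multiplies the new node number, which
  is added to the child found. The proof executes the four cases long or short, missing or
  present.\<close>

lemma child_step_wp:
  assumes inv: "inv p m u" and ready: "ready m"
    and v: "m (Reg 0) = walk (child m) (Suc a) ds" "0 < m (Reg 0)"
    and a: "a < A" "Reg (fst jl) \<in> W"
    and path: "(a, ds @ [digit p jl]) \<in> paths"
  shows "wp x B (child_step jl)
    (\<lambda>m u. inv p m u \<and> ready m \<and> m (Reg 0) = walk (child m) (Suc a) (ds @ [digit p jl]) \<and>
           0 < m (Reg 0)) m u"
proof -
  obtain j l where jl: "jl = (j, l)" by fastforce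
  define e where "e = digit p jl"
  define v where "v = m (Reg 0)"
  define n where "n = m (Reg 14)"
  define w where "w = (if m (slot v e) = 0 then Suc (A + n) else m (slot v e))"
  have e: "e < base" using base(2) by (simp add: e_def)
  have e_eq: "m (Reg (j + 15)) div base ^ l mod base = e"
    using inv by (simp add: e_def jl inv_def)
  have f: "forest A (child m) (A + n)" using inv by (simp add: inv_def n_def)
  have vn: "v \<le> A + n" unfolding v_def v(1) using a(1) by (intro walk_le[OF f]) simp
  have n: "n \<le> M" using allocated_le[OF inv] by (simp add: n_def)
  note b = inv_bounded[OF inv]
  have regs: "m (Reg 3) = base" "m (Reg 4) = c" "m (Reg 5) = K0" "m (Reg 11) = 1" "m (Reg 12) = A"
    "m (Reg 0) = v" "m (Reg 14) = n"
    using ready by (simp_all add: ready_def v_def n_def)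
  have vM: "v * K0 \<le> (A + M) * K0" using vn n by (intro mult_le_mono1) simp
  have K: "(A + M) * K0 + K0 + N \<le> B" by (simp add: B_def algebra_simps)
  \<comment> \<open>The column is computed on short inputs as well, where the root gives no bound;
    there \<open>base\<close> is \<open>K0\<close> and \<open>v mod c\<close> is at most
    \<open>v\<close>.\<close>
  have mod: "v mod c * base + base \<le> B"
  proof (cases "n1 < N")
    case True
    have "Suc (v mod c) * base \<le> c * base" using c by (intro mult_le_mono1) (simp add: Suc_leI)
    then show ?thesis using base_long[OF True] B_bounds(1) by simp
  next
    case False
    then have "base = K0" by (simp add: base_def)
    have "v mod c * K0 \<le> v * K0" by (intro mult_le_mono1) simp
    then show ?thesis unfolding \<open>base = K0\<close> using vM K by linarith
  qed
  have e_le: "e \<le> B" using e B_bounds by linarith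
  have le: "v * K0 \<le> B" "v * K0 + e \<le> B" "v div c \<le> B" "v mod c \<le> B" "v mod c * base \<le> B"
    "v mod c * base + e \<le> B" "Suc (A + n) \<le> B" "A + n \<le> B" "n \<le> B" "Suc n \<le> B" "Suc 0 \<le> B" "v \<le> B"
    using vM K e base(3) mod vn n B_bounds div_le_dividend[of v c] mod_less_eq_dividend[of v c]
    by linarith+
  have step: "inv p m' u' \<and> walk (child m') (Suc a) (ds @ [e]) = w \<and> 0 < w"
    if "bounded_mem B m'" "m' (Reg 14) = (if m (slot v e) = 0 then Suc n else n)"
      "\<And>i. m' (Reg (i + 15)) = m (Reg (i + 15))"
      "\<And>t. m' (Entry 2 t) = m (Entry 2 t)" "m' (slot v e) = w"
      "\<And>v' e'. e' < base \<Longrightarrow> (v', e') \<noteq> (v, e) \<Longrightarrow> m' (slot v' e') = m (slot v' e')"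
      "u' \<subseteq> insert (slot v e) (u \<union> static)" for m' u'
  proof -
    have 1: "v = walk (child m) (Suc a) ds" "0 < v" "(a, ds @ [e]) \<in> paths"
      using v path by (simp_all add: v_def e_def)
    have 2: "w = (if m (slot v e) = 0 then Suc (A + m (Reg 14)) else m (slot v e))"
      "m' (Reg 14) = (if m (slot v e) = 0 then Suc (m (Reg 14)) else m (Reg 14))"
      using that(2) by (simp_all add: w_def n_def)
    show ?thesis
      using inv_child_step[OF inv e 1(1,2) a(1) 1(3) 2(1) that(1) 2(2) that(3-7)] by blast
  qed
  define \<Phi> where "\<Phi> m' u' \<longleftrightarrow> inv p m' u' \<and> ready m' \<and>
    m' (Reg 0) = walk (child m') (Suc a) (ds @ [e]) \<and> 0 < m' (Reg 0)" for m' u'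
  have \<Phi>: "\<Phi> m' u'"
    if "bounded_mem B m'" "m' (Reg 14) = (if m (slot v e) = 0 then Suc n else n)"
      "\<And>i. m' (Reg (i + 15)) = m (Reg (i + 15))"
      "\<And>t. m' (Entry 2 t) = m (Entry 2 t)" "m' (slot v e) = w"
      "\<And>v' e'. e' < base \<Longrightarrow> (v', e') \<noteq> (v, e) \<Longrightarrow> m' (slot v' e') = m (slot v' e')"
      "u' \<subseteq> insert (slot v e) (u \<union> static)"
      "m' (Reg 2) = m (Reg 2)" "m' (Reg 3) = base" "m' (Reg 4) = c" "m' (Reg 5) = K0"
      "m' (Reg 11) = 1" "m' (Reg 12) = A" "m' (Reg 0) = w" for m' u'
    using step[OF that(1-7)] ready that(8-14) by (simp add: \<Phi>_def ready_def)
  have st: "Reg i \<in> static" if "i < 15" for i using that by (simp add: static_def)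
  have st': "Reg (j + 15) \<in> static" "Entry (Suc 0) [v * K0 + e] \<in> static"
    "\<And>s. u \<subseteq> insert s (u \<union> static)"
    using a(2) le by (auto simp: static_def jl)
  have sl: "slot v' e' \<noteq> slot v e" if "e' < base" "(v', e') \<noteq> (v, e)" for v' e'
    using slot_inj[of v' e' v e] that e by auto
  note neq = slot_neq[THEN not_sym]
  have y: "m (slot v e) \<le> B" using b by (rule bounded_memD)
  have le': "n + A \<le> B" "Suc (n + A) \<le> B" "Suc (n + A) * 0 \<le> B" using le by simp_all
  have "wp x B (child_step (j, l)) \<Phi> m u"
  proof (cases "n1 < N")
    case True
    then have big: "m (Reg 2) \<noteq> 0" using ready by (simp add: ready_def)
    have slot: "Entry 0 [v div c, v mod c * base + e] = slot v e"
      "slot v' e' \<noteq> Entry (Suc 0) t" for v' e' t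
      using True by (simp_all add: slot_def)
    \<comment> \<open>The value read from array 1 is arbitrary here and passes through register 10,
      so only its size matters.\<close>
    have t: "m (Entry (Suc 0) [v * K0 + e]) \<le> B" using b by (rule bounded_memD)
    show ?thesis
    proof (cases "m (slot v e) = 0")
      case True
      show ?thesis
        by (simp add: True regs e_eq entry_at_def bounded_mem_upd b le le' t e_le big slot neq add.commute[of n A], rule \<Phi>)
          (simp_all add: True regs bounded_mem_upd b le le' y e_le neq slot w_def st st' sl)
    next
      case False
      then have z: "Suc 0 - m (slot v e) = 0" by simp
      show ?thesis
        by (simp add: False z regs e_eq entry_at_def bounded_mem_upd b le le' t y e_le big slot neq del: diff_is_0_eq, rule \<Phi>)
          (simp_all add: False z regs bounded_mem_upd b le le' y e_le neq slot w_def st st' sl)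
    qed
  next
    case False
    then have big: "m (Reg 2) = 0" using ready by (simp add: ready_def)
    have slot: "Entry (Suc 0) [v * K0 + e] = slot v e"
      using False by (simp add: slot_def)
    have st'': "slot v e \<in> static" using st'(2) slot by simp
    show ?thesis
    proof (cases "m (slot v e) = 0")
      case True
      show ?thesis
        by (simp add: True regs e_eq entry_at_def bounded_mem_upd b le le' e_le big slot neq add.commute[of n A], rule \<Phi>)
          (simp_all add: True regs bounded_mem_upd b le le' y e_le neq slot w_def st st' st'' sl)
    next
      case False
      then have z: "Suc 0 - m (slot v e) = 0" by simp
      show ?thesis
        by (simp add: False z regs e_eq entry_at_def bounded_mem_upd b le le' y e_le big slot neq del: diff_is_0_eq, rule \<Phi>)
          (simp_all add: False z regs bounded_mem_upd b le le' y e_le neq slot w_def st st' st'' sl)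
    qed
  qed
  moreover have "\<Phi> = (\<lambda>m u. inv p m u \<and> ready m \<and>
      m (Reg 0) = walk (child m) (Suc a) (ds @ [digit p jl]) \<and> 0 < m (Reg 0))"
    by (intro ext) (simp only: \<Phi>_def e_def)
  ultimately show ?thesis by (simp only: jl)
qed

text \<open>Induction with the prefix \<open>ds\<close> already followed; the assumption on prefixes
  is unaffected when a digit moves from \<open>jls\<close> to \<open>ds\<close>. Digits depend on
  \<open>p\<close>, which no step changes.\<close>

lemma child_steps_wp:
  assumes "inv p m u" "ready m" "m (Reg 0) = walk (child m) (Suc a) ds" "0 < m (Reg 0)"
    and "a < A" "\<forall>jl\<in>set jls. Reg (fst jl) \<in> W"
    and "\<And>i. (a, take i (ds @ map (digit p) jls)) \<in> paths"
  shows "wp x B (concat (map child_step jls))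
    (\<lambda>m u. inv p m u \<and> ready m \<and> m (Reg 0) = walk (child m) (Suc a) (ds @ map (digit p) jls) \<and>
           0 < m (Reg 0)) m u"
  using assms
proof (induction jls arbitrary: ds m u)
  case (Cons jl jls)
  have path: "(a, ds @ [digit p jl]) \<in> paths"
    using Cons.prems(7)[of "Suc (length ds)"] by simp
  have "wp x B (child_step jl) (wp x B (concat (map child_step jls))
    (\<lambda>m u. inv p m u \<and> ready m \<and>
      m (Reg 0) = walk (child m) (Suc a) ((ds @ [digit p jl]) @ map (digit p) jls) \<and>
      0 < m (Reg 0))) m u"
  proof (rule wp_mono[OF child_step_wp[OF Cons.prems(1-5) _ path]])
    show "Reg (fst jl) \<in> W" using Cons.prems(6) by simp
  next
    fix m u
    assume *: "inv p m u \<and> ready m \<and>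
      m (Reg 0) = walk (child m) (Suc a) (ds @ [digit p jl]) \<and> 0 < m (Reg 0)"
    have "(a, take i ((ds @ [digit p jl]) @ map (digit p) jls)) \<in> paths" for i
      using Cons.prems(7)[of i] by simp
    then show "wp x B (concat (map child_step jls)) (\<lambda>m u. inv p m u \<and> ready m \<and>
      m (Reg 0) = walk (child m) (Suc a) ((ds @ [digit p jl]) @ map (digit p) jls) \<and>
      0 < m (Reg 0)) m u"
      using * Cons.prems(5,6) by (intro Cons.IH) simp_all
  qed
  then show ?case by (simp only: list.map concat.simps wp_append append_assoc append.simps)
qed simp

lemma key_eq: "key (map (\<lambda>j. p (Reg j)) js) = map (digit p) (List.product js [0..<L])"
proof (induction js)
  case (Cons j js)
  then show ?case by (simp add: digits_Cons comp_def)
qed (simp add: digits_def)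

lemma access_wp:
  assumes "inv p m u" "a < A" "Reg ` set js \<subseteq> W"
    and W: "Entry a (map (\<lambda>j. p (Reg j)) js) \<in> W"
  shows "wp x B (access a js) (\<lambda>m u. inv p m u \<and>
    m (Reg 0) = walk (child m) (Suc a) (key (map (\<lambda>j. p (Reg j)) js)) \<and> 0 < m (Reg 0)) m u"
proof -
  have path: "(a, take i (key (map (\<lambda>j. p (Reg j)) js))) \<in> paths" for i
    using W by (auto simp: paths_def)
  have "wp x B (prologue a) (wp x B (concat (map child_step (List.product js [0..<L])))
    (\<lambda>m u. inv p m u \<and> ready m \<and>
      m (Reg 0) = walk (child m) (Suc a) ([] @ key (map (\<lambda>j. p (Reg j)) js)) \<and> 0 < m (Reg 0))) m u"
    unfolding key_eq
    by (rule wp_mono[OF prologue_wp[OF assms(1,2)]], rule child_steps_wp)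
       (use assms(2,3) path in \<open>auto simp: key_eq\<close>)
  then show ?thesis
    unfolding access_def wp_append by (elim wp_mono) simp
qed

text \<open>Positivity says that the node exists, so a store cannot hit index 0, which stands for
  all missing nodes.\<close>

fun addressed :: "memory \<Rightarrow> memory \<Rightarrow> instr \<Rightarrow> bool" where
  "addressed p m (Load i j) \<longleftrightarrow> m (Reg 0) = p (Reg j) + 15"
| "addressed p m (Store i j) \<longleftrightarrow> m (Reg 0) = p (Reg i) + 15"
| "addressed p m (ALoad i a js) \<longleftrightarrow>
     m (Reg 0) = walk (child m) (Suc a) (key (map (\<lambda>j. p (Reg j)) js)) \<and> 0 < m (Reg 0)"
| "addressed p m (AStore a js i) \<longleftrightarrow>
     m (Reg 0) = walk (child m) (Suc a) (key (map (\<lambda>j. p (Reg j)) js)) \<and> 0 < m (Reg 0)"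
| "addressed p m _ \<longleftrightarrow> True"

lemma child_upd_Reg [simp]: "child (m(Reg i := v)) = child m"
  by (intro ext) (simp add: child_def slot_def)

lemma edges_upd_Reg [simp]: "edges (m(Reg i := v)) = edges m"
  by (simp add: edges_def)

lemma prep_wp:
  assumes "inv p m u" "bounded_mem V p" "touched p i \<subseteq> W" "wf_instr (dims P) i"
  shows "wp x B (prep i) (\<lambda>m u. inv p m u \<and> addressed p m i) m u"
proof -
  note b = inv_bounded[OF assms(1)]
  have reg: "m (Reg (j + 15)) = p (Reg j)" for j using assms(1) by (simp add: inv_def)
  have st: "Reg i \<in> static" if "i < 15" for i using that by (simp add: static_def)
  have st': "Reg (j + 15) \<in> static" if "Reg j \<in> W" for j using that by (auto simp: static_def)
  have le: "15 + p (Reg j) \<le> B" for j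
    using bounded_memD[OF assms(2), of "Reg j"] by (simp add: B_def)
  show ?thesis
  proof (cases i)
    case (Load r j)
    then show ?thesis using assms(3)
      by (simp add: bounded_mem_upd b reg le B_bounds inv_cong[OF assms(1)] st st')
  next
    case (Store r j)
    then show ?thesis using assms(3)
      by (simp add: bounded_mem_upd b reg le B_bounds inv_cong[OF assms(1)] st st')
  next
    case (ALoad r a js)
    then show ?thesis
      using access_wp[OF assms(1), of a js] assms(3,4) by (simp add: entry_at_def)
  next
    case (AStore a js r)
    then show ?thesis
      using access_wp[OF assms(1), of a js] assms(3,4) by (simp add: entry_at_def)
  qed (use assms(1) in simp_all)
qed

lemma addressed_upd_Reg: "addressed p m i \<Longrightarrow> 0 < r \<Longrightarrow> addressed p (m(Reg r := v)) i"
  by (cases i) simp_all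

lemma padded_wp:
  assumes "inv p m u" "bounded_mem V p" "touched p i \<subseteq> W" "wf_instr (dims P) i"
  shows "wp x B (padded i) (\<lambda>m u. inv p m u \<and> addressed p m i) m u"
proof -
  have nops: "wp x B (replicate n (Plain (Const 6 0))) (\<lambda>m u. inv p m u \<and> addressed p m i) m u"
    if "inv p m u \<and> addressed p m i" for n m u
    using that
  proof (induction n arbitrary: m u)
    case (Suc n)
    then have b: "bounded_mem B (m(Reg 6 := 0))"
      by (intro bounded_mem_upd inv_bounded[of p m u]) simp_all
    have "inv p (m(Reg 6 := 0)) (u \<union> {Reg 6})"
      by (rule inv_cong[of p m u]) (use Suc.prems b in \<open>simp_all add: static_def\<close>)
    with Suc.prems have "inv p (m(Reg 6 := 0)) (u \<union> {Reg 6}) \<and> addressed p (m(Reg 6 := 0)) i"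
      by (simp only: addressed_upd_Reg zero_less_numeral)
    from Suc.IH[OF this] b show ?case by (simp del: fun_upd_apply)
  qed simp
  show ?thesis
    unfolding padded_def wp_append by (rule wp_mono[OF prep_wp[OF assms]]) (rule nops)
qed

lemma inv_write_reg:
  assumes "inv p m u" "v \<le> V" "u' \<subseteq> u \<union> static"
  shows "inv (p(Reg i := v)) (m(Reg (i + 15) := v)) u'"
  using assms B_bounds(3) unfolding inv_def by (auto simp: bounded_mem_upd)

text \<open>No other represented cell changes: by \<open>walk_inj\<close> and
  \<open>digits_inj\<close>, different cells never share an existing node.\<close>

lemma inv_write_entry:
  assumes "inv p m u" "v \<le> V" "u' \<subseteq> u \<union> static"
    and node: "node = walk (child m) (Suc a) (key ns)" "0 < node" and a: "a < A"
    and ns: "\<forall>n\<in>set ns. n \<le> V"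
  shows "inv (p(Entry a ns := v)) (m(Entry 2 [node] := v)) u'"
proof -
  let ?m = "m(Entry 2 [node] := v)"
  have f: "forest A (child m) (A + m (Reg 14))" using assms(1) by (simp add: inv_def)
  have ch: "child ?m = child m" by (intro ext) (simp add: child_def slot_neq[THEN not_sym])
  have ed: "edges ?m = edges m" by (simp add: edges_def ch)
  have node_le: "node \<le> A + m (Reg 14)" unfolding node(1) using a by (intro walk_le[OF f]) simp
  have iff: "walk (child m) (Suc b) (key ks) = node \<longleftrightarrow> Entry b ks = Entry a ns"
    if "b < A" "\<forall>n\<in>set ks. n \<le> V" for b ks
  proof
    assume "walk (child m) (Suc b) (key ks) = node"
    then have "b = a \<and> key ks = key ns"
      using walk_inj[OF f \<open>b < A\<close> a] node by simp
    moreover have "\<forall>n\<in>set ks. n < base ^ L" "\<forall>n\<in>set ns. n < base ^ L"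
      using that(2) ns base(1) by fastforce+
    ultimately show "Entry b ks = Entry a ns" using digits_inj L by auto
  qed (use node in simp)
  have "(p(Entry a ns := v)) (Entry b ks) = ?m (Entry 2 [walk (child m) (Suc b) (key ks)])"
    if "b < A" "\<forall>n\<in>set ks. n \<le> V" for b ks
    using iff[OF that] assms(1) that unfolding inv_def by (simp add: eq_commute[of node])
  moreover have "bounded_mem B ?m"
    using inv_bounded[OF assms(1)] assms(2) B_bounds(3) by (simp add: bounded_mem_upd)
  ultimately show ?thesis
    using assms(1,3) node(2) node_le unfolding inv_def ch ed by auto
qed

lemma node_static:
  assumes "inv p m u" "a < A"
  shows "Entry 2 [walk (child m) (Suc a) ds] \<in> static"
proof -
  have "walk (child m) (Suc a) ds \<le> A + m (Reg 14)"
    using assms by (intro walk_le[of A]) (simp_all add: inv_def)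
  then show ?thesis using allocated_le[OF assms(1)] by (simp add: static_def)
qed

lemma final_step:
  assumes inv: "inv (mem s) (mem q) u" and ad: "addressed (mem s) (mem q) i"
    and V: "bounded_mem V (mem s)" "bounded_mem V (mem (exec P x i s))"
    and i: "touched (mem s) i \<subseteq> W" "wf_instr (dims P) i"
    and q: "pc q = pc s * K + (K - 1)" "out q = out s"
  shows "pc (exec Q x (final i) q) = pc (exec P x i s) * K"
    "out (exec Q x (final i) q) = out (exec P x i s)"
    "inv (mem (exec P x i s)) (mem (exec Q x (final i) q)) (u \<union> touched (mem q) (final i))"
proof -
  \<comment> \<open>The final instruction sits at offset \<open>K - 1\<close>, so falling through
    enters the next block.\<close>
  have pc: "Suc (pc q) = Suc (pc s) * K" using K_pos by (simp add: q(1))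
  have reg: "mem q (Reg (j + 15)) = mem s (Reg j)" for j using inv by (simp add: inv_def)
  show "pc (exec Q x (final i) q) = pc (exec P x i s) * K"
    using pc by (cases i) (simp_all add: assign_def reg length_code_Q)
  show "out (exec Q x (final i) q) = out (exec P x i s)"
    using q by (cases i) (simp_all add: assign_def reg)
  have st: "Reg 0 \<in> static" "Reg j \<in> W \<Longrightarrow> Reg (j + 15) \<in> static" for j
    by (auto simp: static_def)
  have Vs: "mem s (Reg j) \<le> V" "mem (exec P x i s) c' \<le> V" for j c'
    using V by (simp_all add: bounded_mem_def)
  \<comment> \<open>The value written is bounded because it appears in the next memory of
    \<open>P\<close>, whatever the instruction.\<close>
  have tgt: "v \<le> V" if "mem (exec P x i s) = (mem s)(c' := v)" for c' v
    using Vs(2)[of c'] by (simp add: that)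
  show "inv (mem (exec P x i s)) (mem (exec Q x (final i) q)) (u \<union> touched (mem q) (final i))"
  proof (cases i)
    case (ALoad r a js)
    let ?ns = "map (\<lambda>j. mem s (Reg j)) js"
    have *: "a < A" "\<forall>n\<in>set ?ns. n \<le> V" using i(2) Vs by (auto simp: ALoad)
    have node: "mem q (Reg 0) = walk (child (mem q)) (Suc a) (key ?ns)"
      using ad by (simp add: ALoad)
    have eq: "mem q (Entry 2 [mem q (Reg 0)]) = mem s (Entry a ?ns)"
      using inv * by (simp add: inv_def node)
    have "Entry 2 [mem q (Reg 0)] \<in> static"
      using node_static[OF inv *(1)] node by simp
    then show ?thesis
      using i(1) tgt[of "Reg r"]
      by (simp add: ALoad assign_def entry_at_def eq inv_write_reg[OF inv] st)
  next
    case (AStore a js r)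
    let ?ns = "map (\<lambda>j. mem s (Reg j)) js"
    have *: "a < A" "\<forall>n\<in>set ?ns. n \<le> V" using i(2) Vs by (auto simp: AStore)
    have node: "mem q (Reg 0) = walk (child (mem q)) (Suc a) (key ?ns)" "0 < mem q (Reg 0)"
      using ad by (simp_all add: AStore)
    have "Entry 2 [mem q (Reg 0)] \<in> static"
      using node_static[OF inv *(1)] node by simp
    then show ?thesis
      using i(1) tgt[of "Entry a ?ns"]
      by (simp add: AStore assign_def entry_at_def reg inv_write_entry[OF inv _ _ node *] st)
  next
    case (Load r j)
    then show ?thesis using ad i(1) tgt
      by (simp add: assign_def reg inv_write_reg[OF inv] st)
  next
    case (Store r j)
    then show ?thesis using ad i(1) tgt
      by (simp add: assign_def reg inv_write_reg[OF inv] st)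
  next
    case (Input r j)
    then show ?thesis using i(1) tgt[of "Reg r"]
      by (simp add: assign_def reg Let_def inv_write_reg[OF inv] st)
  next
    case (Arith f r j l)
    then show ?thesis using i(1) tgt[of "Reg r"]
      by (simp add: assign_def reg inv_write_reg[OF inv] st)
  next
    case (Const r n)
    then show ?thesis using i(1) tgt[of "Reg r"]
      by (simp add: assign_def reg inv_write_reg[OF inv] st)
  next
    case (Size r)
    then show ?thesis using i(1) tgt[of "Reg r"]
      by (simp add: assign_def reg inv_write_reg[OF inv] st)
  next
    case (Root e r j)
    then show ?thesis using i(1) tgt[of "Reg r"]
      by (simp add: assign_def reg inv_write_reg[OF inv] st)
  next
    case (Digit r l j b)
    then show ?thesis using i(1) tgt[of "Reg r"]
      by (simp add: assign_def reg inv_write_reg[OF inv] st)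
  next
    case (JZero r l)
    have "inv (mem s) (mem q) (insert (Reg (r + 15)) u)"
      using i(1) st by (intro inv_cong[OF inv inv_bounded[OF inv]]) (auto simp: JZero)
    then show ?thesis by (simp add: JZero)
  next
    case (Output r)
    have "inv (mem s) (mem q) (insert (Reg (r + 15)) u)"
      using i(1) st by (intro inv_cong[OF inv inv_bounded[OF inv]]) (auto simp: Output)
    then show ?thesis by (simp add: Output)
  next
    case Halt
    then show ?thesis using inv by simp
  qed
qed

text \<open>All-zero memory already encodes the forest of \<open>A\<close> bare roots.\<close>

lemma inv_init: "inv (mem init) (mem init) {}"
  by (simp add: inv_def init_def bounded_mem_def forest_def child_def cong: if_cong)

text \<open>One step of \<open>P\<close> costs one block; skipped guarded instructions make the time
  at most, not exactly, \<open>K * n\<close>.\<close>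

lemma simulation:
  assumes "wf_ram P" "\<And>n. bounded_mem V (mem (run P x n))" "\<And>n. used_cells P x n \<subseteq> W"
  shows "\<exists>n' \<le> K * n. pc (run Q x n') = pc (run P x n) * K \<and> out (run Q x n') = out (run P x n) \<and>
    inv (mem (run P x n)) (mem (run Q x n')) (used_cells Q x n') \<and>
    (\<forall>i\<le>n'. bounded_mem B (mem (run Q x i)))"
proof (induction n)
  case 0
  show ?case using inv_init inv_bounded[OF inv_init] by (simp add: init_def)
next
  case (Suc n)
  then obtain n' where n': "n' \<le> K * n" "pc (run Q x n') = pc (run P x n) * K"
    "out (run Q x n') = out (run P x n)"
    "inv (mem (run P x n)) (mem (run Q x n')) (used_cells Q x n')"
    "\<forall>i\<le>n'. bounded_mem B (mem (run Q x i))" by blast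
  let ?s = "run P x n"
  show ?case
  proof (cases "halted P ?s")
    case True
    then show ?thesis using n' by (intro exI[of _ n']) (simp add: run_Suc step_def)
  next
    case False
    define i where "i = code P ! pc ?s"
    have p: "pc ?s < length (code P)" using False by (simp add: halted_def)
    have i: "touched (mem ?s) i \<subseteq> W" "wf_instr (dims P) i"
      using assms(1) assms(3)[of "Suc n"] False p
      by (auto simp: used_cells_Suc i_def wf_ram_def)
    have glen: "glength (padded i) = K - 1" using glength_padded[OF p] by (simp add: i_def)
    have code: "pc ?s * K + j < length (code Q) \<and>
        code Q ! (pc ?s * K + j) = compile (pc ?s * K) (padded i) ! j"
      if "j < glength (padded i)" for j
      using that code_Q[OF p, of j] glen by (simp add: block_def i_def nth_append)
    have "\<exists>n2 \<le> n' + glength (padded i). pc (run Q x n2) = pc ?s * K + glength (padded i) \<and>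
        out (run Q x n2) = out (run Q x n') \<and>
        (inv (mem ?s) (mem (run Q x n2)) (used_cells Q x n2) \<and>
         addressed (mem ?s) (mem (run Q x n2)) i) \<and>
        (\<forall>i\<le>n2. bounded_mem B (mem (run Q x i)))"
      by (rule wp_sound[OF padded_wp[OF n'(4) assms(2) i] n'(2) code n'(5)])
    then obtain n2 where n2: "n2 \<le> n' + (K - 1)" "pc (run Q x n2) = pc ?s * K + (K - 1)"
        "out (run Q x n2) = out ?s"
        "inv (mem ?s) (mem (run Q x n2)) (used_cells Q x n2)"
        "addressed (mem ?s) (mem (run Q x n2)) i"
        "\<forall>i\<le>n2. bounded_mem B (mem (run Q x i))"
      by (auto simp: glen n'(3))
    have "K - 1 < K" using K_pos by simp
    note c = code_Q[OF p this]
    have ci: "code Q ! pc (run Q x n2) = final i"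
      using c(2) glen by (simp add: n2(2) block_def i_def nth_append)
    have nh: "\<not> halted Q (run Q x n2)" using c(1) by (simp add: halted_def n2(2))
    have Ps: "run P x (Suc n) = exec P x i ?s" using False by (simp add: run_Suc step_def i_def)
    have Qs: "run Q x (Suc n2) = exec Q x (final i) (run Q x n2)"
      using nh ci by (simp add: run_Suc step_def)
    have Qu: "used_cells Q x (Suc n2) = used_cells Q x n2 \<union> touched (mem (run Q x n2)) (final i)"
      using nh ci by (simp add: used_cells_Suc)
    have V: "bounded_mem V (mem (exec P x i ?s))" using assms(2)[of "Suc n"] by (simp add: Ps)
    note fin = final_step[OF n2(4,5) assms(2) V i n2(2,3), folded Ps Qs Qu]
    have "Suc n2 \<le> n' + K" using n2(1) K_pos by simp
    then have "Suc n2 \<le> K * Suc n" using n'(1) by simp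
    moreover have "\<forall>i\<le>Suc n2. bounded_mem B (mem (run Q x i))"
      using n2(6) inv_bounded[OF fin(3)] by (auto simp: le_Suc_eq)
    ultimately show ?thesis using fin by blast
  qed
qed

section \<open>Resource bounds for the whole run on one input\<close>

lemma finite_static: "finite static" and card_static: "card static \<le> 17 + card W + B + A + M"
proof -
  have eq: "{Reg (i + 15) | i. Reg i \<in> W} = Reg ` (\<lambda>i. i + 15) ` Reg -` W" by auto
  have fin: "finite (Reg -` W)" using W(1) by (intro finite_vimageI) (auto simp: inj_def)
  have "card (Reg -` W) \<le> card W"
    using W(1) by (intro card_inj_on_le[of Reg]) (auto simp: inj_on_def)
  moreover have "card (Reg ` (\<lambda>i. i + 15) ` Reg -` W) \<le> card (Reg -` W)"
    using fin by (meson card_image_le finite_imageI le_trans)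
  ultimately have 1: "card {Reg (i + 15) | i. Reg i \<in> W} \<le> card W" by (simp add: eq)
  show "finite static" using fin by (simp add: static_def eq)
  have c: "card (Reg ` {..<15}) \<le> 15" "card ((\<lambda>i. Entry 1 [i]) ` {..B}) \<le> Suc B"
    "card ((\<lambda>i. Entry 2 [i]) ` {..A + M}) \<le> Suc (A + M)"
    using card_image_le[of "{..<15}" Reg] card_image_le[of "{..B}" "\<lambda>i. Entry 1 [i]"]
      card_image_le[of "{..A + M}" "\<lambda>i. Entry 2 [i]"] by simp_all
  have "card static \<le> card (Reg ` {..<15}) + card {Reg (i + 15) | i. Reg i \<in> W} +
     card ((\<lambda>i. Entry 1 [i]) ` {..B}) + card ((\<lambda>i. Entry 2 [i]) ` {..A + M})"
    unfolding static_def by (meson add_le_mono1 card_Un_le le_trans)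
  \<comment> \<open>17 is made up of 15 working registers and index 0 of each of the arrays 1 and
    2.\<close>
  then show "card static \<le> 17 + card W + B + A + M" using 1 c by linarith
qed

text \<open>The invariant is known only between blocks, but the cells used at any time are among
  those used at the halting time, where it holds.\<close>

lemma simulation_halted:
  assumes "wf_ram P" "\<And>n. bounded_mem V (mem (run P x n))" "\<And>n. used_cells P x n \<subseteq> W"
    and "halted P (run P x h)"
  shows "\<exists>n \<le> K * h. halted Q (run Q x n) \<and> out (run Q x n) = out (run P x h)"
    and "bounded_mem B (mem (run Q x n))"
    and "card (used_cells Q x n) \<le> 17 + card W + B + A + 2 * M"
    and "Entry a [i, j] \<in> used_cells Q x n \<Longrightarrow> i < N \<and> j < nth_root_nat d N"
proof -
  obtain n' where n': "n' \<le> K * h" "pc (run Q x n') = pc (run P x h) * K"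
    "out (run Q x n') = out (run P x h)"
    "inv (mem (run P x h)) (mem (run Q x n')) (used_cells Q x n')"
    "\<forall>i\<le>n'. bounded_mem B (mem (run Q x i))"
    using simulation[OF assms(1-3), of h] by blast
  have h: "halted Q (run Q x n')"
    using assms(4) by (simp add: halted_def n'(2) length_code_Q)
  show "\<exists>n \<le> K * h. halted Q (run Q x n) \<and> out (run Q x n) = out (run P x h)"
    using n' h by blast
  show "bounded_mem B (mem (run Q x n))"
    using n'(5) run_halted[OF h, of n] by (cases "n \<le> n'") auto
  have u: "used_cells Q x n \<subseteq> used_cells Q x n'" by (rule used_cells_halted[OF h])
  have "used_cells Q x n' \<subseteq> static \<union> edges (mem (run Q x n'))" using n'(4) by (simp add: inv_def)
  with u have "card (used_cells Q x n) \<le> card (static \<union> edges (mem (run Q x n')))"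
    using finite_static card_edges(1)[OF n'(4)] by (intro card_mono) auto
  also have "\<dots> \<le> card static + card (edges (mem (run Q x n')))" by (rule card_Un_le)
  finally show "card (used_cells Q x n) \<le> 17 + card W + B + A + 2 * M"
    using card_static card_edges(2)[OF n'(4)] by linarith
  show "i < N \<and> j < nth_root_nat d N" if "Entry a [i, j] \<in> used_cells Q x n"
    using edges_within_bounds[OF n'(4)] that u by blast
qed

end

section \<open>Choice of the constants\<close>

lemma computes_iff:
  assumes "halted P (run P x h)"
  shows "computes P x y \<longleftrightarrow> y = out (run P x h)"
proof
  assume "computes P x y"
  then obtain n where "halted P (run P x n)" "out (run P x n) = y" by (auto simp: computes_def)
  moreover from this have "run P x n = run P x h" using assms by (metis nat_le_linear run_halted)
  ultimately show "y = out (run P x h)" by simp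
qed (use assms in \<open>auto simp: computes_def\<close>)

lemma used_entry:
  assumes "wf_ram P" "has_arrays_upto k P" "Entry a ns \<in> used_cells P x n"
  shows "a < length (dims P) \<and> length ns \<le> k"
proof -
  obtain m where m: "\<not> halted P (run P x m)"
    "Entry a ns \<in> touched (mem (run P x m)) (code P ! pc (run P x m))"
    using assms(3) by (auto simp: used_cells_def)
  have "wf_instr (dims P) (code P ! pc (run P x m))"
    using assms(1) m(1) by (auto simp: wf_ram_def halted_def)
  then show ?thesis
    using m(2) assms(2)
    by (cases "code P ! pc (run P x m)") (auto simp: entry_at_def has_arrays_upto_def)
qed

lemma linear_bound:
  assumes "(\<lambda>N. real (f N)) \<in> O(\<lambda>N. real N)"
  shows "\<exists>C n0. \<forall>N\<ge>n0. f N \<le> C * N"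
proof -
  obtain r where "\<forall>\<^sub>F N in sequentially. norm (real (f N)) \<le> r * norm (real N)"
    using assms by (auto elim: landau_o.bigE)
  then obtain n0 where n0: "\<And>N. N \<ge> n0 \<Longrightarrow> real (f N) \<le> r * real N"
    by (auto simp: eventually_sequentially)
  have "f N \<le> nat \<lceil>r\<rceil> * N" if "N \<ge> n0" for N
  proof -
    have "real (f N) \<le> r * real N" using n0 that by simp
    also have "\<dots> \<le> real (nat \<lceil>r\<rceil>) * real N" by (intro mult_right_mono) linarith+
    finally show ?thesis by (simp flip: of_nat_mult)
  qed
  then show ?thesis by blast
qed

text \<open>With r the root and b = r div c, the size of N forces b to be at least 2c; then r + 1 is
  at most c(b + 1), hence at most 2cb and b^2, and N < (r + 1)^d. The remaining e digits contribute
  the factor 2^e.\<close>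

lemma root_power_bound:
  fixes c e d N :: nat
  assumes "1 \<le> c" "1 \<le> d" "(2 * c * c + 1) ^ d \<le> N"
  shows "2 ^ e * N < (nth_root_nat d N div c) ^ (2 * d + e)"
proof -
  define r where "r = nth_root_nat d N"
  define b where "b = r div c"
  have N: "N < Suc r ^ d"
    using nth_root_nat_ge[of d "Suc r" N] assms(2) unfolding r_def by linarith
  then have "(2 * c * c + 1) ^ d < Suc r ^ d" using assms(3) by linarith
  then have "2 * c * c + 1 < Suc r" by (rule power_less_imp_less_base) simp
  then have "2 * c \<le> b"
    unfolding b_def using assms(1) by (subst less_eq_div_iff_mult_less_eq) auto
  have "r < c * Suc b" unfolding b_def using assms(1) by (simp add: dividend_less_times_div)
  then have "Suc r \<le> c * Suc b" by simp
  also have "\<dots> \<le> (2 * c) * b" using \<open>2 * c \<le> b\<close> assms(1) by simp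
  also have "\<dots> \<le> b ^ 2" unfolding power2_eq_square using \<open>2 * c \<le> b\<close> by (rule mult_le_mono1)
  finally have "Suc r ^ d \<le> (b ^ 2) ^ d" by (rule power_mono) simp
  with N have "N < b ^ (2 * d)" by (simp add: power_mult)
  moreover have "2 ^ e \<le> b ^ e" using \<open>2 * c \<le> b\<close> assms(1) by (intro power_mono) auto
  moreover have "0 < b ^ e" using \<open>2 * c \<le> b\<close> assms(1) by simp
  ultimately have "2 ^ e * N < b ^ e * b ^ (2 * d)" by (meson le_less_trans mult_le_mono1 mult_less_mono2)
  then show ?thesis by (simp add: b_def r_def power_add mult.commute)
qed

theorem theorem2p2:
  fixes k d :: nat and P :: ram and D :: "nat list set" and t :: "nat \<Rightarrow> real"
  assumes "k > 1" and "d \<ge> 1"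
    and "wf_ram P" and "has_arrays_upto k P"
    and "linear_values P D" and "linear_space P D" and "runs_in_time P D t"
  shows "\<exists>Q. wf_ram Q \<and> one_2d_array Q \<and> within_2d_bounds d Q D \<and>
           linear_values Q D \<and> linear_space Q D \<and> runs_in_time Q D t \<and>
           simulates Q P D"
proof -
  obtain V where V: "(\<lambda>N. real (V N)) \<in> O(\<lambda>N. real N)"
    "\<And>x e. x \<in> D \<Longrightarrow> e \<in> set x \<Longrightarrow> e \<le> V (length x)"
    "\<And>x n. x \<in> D \<Longrightarrow> bounded_mem (V (length x)) (mem (run P x n))"
    using assms(5) unfolding linear_values_def bounded_mem_def by blast
  obtain S where S: "(\<lambda>N. real (S N)) \<in> O(\<lambda>N. real N)"
    "\<And>x n. x \<in> D \<Longrightarrow> card (used_cells P x n) \<le> S (length x)"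
    using assms(6) unfolding linear_space_def by blast
  obtain T where T: "(\<lambda>N. real (T N)) \<in> O(t)"
    "\<And>x. x \<in> D \<Longrightarrow> \<exists>n \<le> T (length x). halted P (run P x n)"
    using assms(7) unfolding runs_in_time_def by blast
  obtain cV nV where cV: "\<And>N. nV \<le> N \<Longrightarrow> V N \<le> cV * N" using linear_bound[OF V(1)] by blast
  obtain cS nS where cS: "\<And>N. nS \<le> N \<Longrightarrow> S N \<le> cS * N" using linear_bound[OF S(1)] by blast
  \<comment> \<open>Of these digits, 2d account for N itself and \<open>cV\<close> for the factor
    \<open>cV\<close>, which is at most \<open>2 ^ cV\<close>.\<close>
  define L where "L = 2 * d + cV"
  define M where "M = (\<lambda>N. S N * Suc (k * L))"
  \<comment> \<open>Roots plus non-root nodes per unit of N; the 1 makes the bound on nodes strict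
    and \<open>c\<close> positive.\<close>
  define c where "c = length (dims P) + cS * Suc (k * L) + 1"
  \<comment> \<open>Beyond this size both linear bounds and \<open>root_power_bound\<close>
    apply.\<close>
  define n1 where "n1 = nV + nS + (2 * c * c + 1) ^ d"
  \<comment> \<open>The sum dominates each of the finitely many \<open>V i\<close> of short
    inputs.\<close>
  define K0 where "K0 = Suc (\<Sum>i\<le>n1. V i)"
  interpret C: sim_code P d L c K0 n1 .
  define B where "B = (\<lambda>N. (C.A + M N + 2) * (K0 + 2) + 2 * N + V N + c + n1 + 15)"
  have long: "C.A + M N < c * N \<and> V N < (nth_root_nat d N div c) ^ L" if "n1 < N" for N
  proof
    have "0 < N" using that by simp
    have "M N \<le> cS * N * Suc (k * L)"
      unfolding M_def using that by (intro mult_le_mono1 cS) (simp add: n1_def)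
    moreover have "C.A \<le> C.A * N" using \<open>0 < N\<close> by simp
    moreover have "c * N = C.A * N + cS * N * Suc (k * L) + N" by (simp add: c_def algebra_simps)
    ultimately show "C.A + M N < c * N" using \<open>0 < N\<close> by linarith
    have "V N \<le> cV * N" using that by (intro cV) (simp add: n1_def)
    also have "\<dots> \<le> 2 ^ cV * N" by (intro mult_le_mono1) (simp add: less_imp_le)
    also have "\<dots> < (nth_root_nat d N div c) ^ L"
      unfolding L_def using that assms(2)
      by (intro root_power_bound) (auto simp: n1_def c_def)
    finally show "V N < (nth_root_nat d N div c) ^ L" .
  qed
  have short: "V N < K0" if "N \<le> n1" for N
    using member_le_sum[of N "{..n1}" V] that by (simp add: K0_def less_Suc_eq_le)
  have sim: "\<exists>h \<le> T (length x). halted P (run P x h) \<and>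
      (\<exists>n \<le> C.K * h. halted C.Q (run C.Q x n) \<and> out (run C.Q x n) = out (run P x h)) \<and>
      (\<forall>n. bounded_mem (B (length x)) (mem (run C.Q x n)) \<and>
        card (used_cells C.Q x n) \<le> 17 + S (length x) + B (length x) + C.A + 2 * M (length x) \<and>
        (\<forall>a i j. Entry a [i, j] \<in> used_cells C.Q x n \<longrightarrow>
          i < length x \<and> j < nth_root_nat d (length x)))"
    if xD: "x \<in> D" for x
  proof -
    obtain h where h: "h \<le> T (length x)" "halted P (run P x h)" using T(2)[OF xD] by blast
    \<comment> \<open>As \<open>P\<close> halts at time \<open>h\<close>, this finite set contains
      all cells it ever uses and limits the forest in advance for the whole run.\<close>
    define W where "W = used_cells P x h"
    have W: "used_cells P x n \<subseteq> W" for n unfolding W_def by (rule used_cells_halted[OF h(2)])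
    have cW: "card W \<le> S (length x)" unfolding W_def by (rule S(2)[OF xD])
    interpret R: sim_run P d L c K0 n1 x k "V (length x)" "M (length x)" W
    proof
      show "1 \<le> L" "1 \<le> c" using assms(2) by (simp_all add: L_def c_def)
      show "card W * Suc (k * L) \<le> M (length x)" unfolding M_def using cW by (rule mult_le_mono1)
      show "a < C.A \<and> length ns \<le> k" if "Entry a ns \<in> W" for a ns
        using used_entry[OF assms(3,4)] that unfolding W_def .
    qed (use assms(2) long short in \<open>auto simp: W_def finite_used_cells\<close>)
    have B: "R.B = B (length x)" by (simp add: R.B_def B_def)
    note sh = R.simulation_halted[OF assms(3) V(3)[OF xD] W h(2)]
    have "card (used_cells C.Q x n) \<le> 17 + S (length x) + B (length x) + C.A + 2 * M (length x)" for n
      using sh(3)[of n] cW by (simp add: B)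
    then show ?thesis using h sh(1,2,4) unfolding B by blast
  qed
  have M_lin: "(\<lambda>N. real (M N)) \<in> O(\<lambda>N. real N)"
    unfolding M_def of_nat_mult using S(1) by simp
  have const: "(\<lambda>N. C :: real) \<in> O(\<lambda>N. real N)" for C
    by (intro bigoI[of _ "norm C"] eventually_sequentiallyI[of 1])
       (use mult_left_mono[of 1 _ "norm C"] in auto)
  have "(\<lambda>N. real C.A + real (M N) + 2) \<in> O(\<lambda>N. real N)"
    by (intro sum_in_bigo const M_lin)
  then have B_lin: "(\<lambda>N. real (B N)) \<in> O(\<lambda>N. real N)"
    unfolding B_def of_nat_add of_nat_mult
    by (intro sum_in_bigo const V(1)) simp_all
  have wf: "wf_ram C.Q" by (rule C.wf_Q[OF assms(3,2)])
  have one: "one_2d_array C.Q" by (simp add: one_2d_array_def C.Q_def)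
  have within: "within_2d_bounds d C.Q D"
    using sim unfolding within_2d_bounds_def by blast
  have vals: "linear_values C.Q D"
    unfolding linear_values_def
  proof (intro exI[of _ "\<lambda>N. B N + V N"] conjI ballI allI)
    show "(\<lambda>N. real (B N + V N)) \<in> O(\<lambda>N. real N)"
      unfolding of_nat_add by (intro sum_in_bigo B_lin V(1))
    show "e \<le> B (length x) + V (length x)" if "x \<in> D" "e \<in> set x" for x e
      using V(2)[OF that] by simp
    show "mem (run C.Q x n) a \<le> B (length x) + V (length x)" if "x \<in> D" for x n a
      using sim[OF that] by (meson bounded_memD le_add1 le_trans)
  qed
  have space: "linear_space C.Q D"
    unfolding linear_space_def
  proof (intro exI[of _ "\<lambda>N. 17 + S N + B N + C.A + 2 * M N"] conjI ballI allI)
    show "(\<lambda>N. real (17 + S N + B N + C.A + 2 * M N)) \<in> O(\<lambda>N. real N)"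
      unfolding of_nat_add of_nat_mult
      by (intro sum_in_bigo const B_lin S(1)) (use M_lin in simp)
    show "card (used_cells C.Q x n) \<le> 17 + S (length x) + B (length x) + C.A + 2 * M (length x)"
      if "x \<in> D" for x n
      using sim[OF that] by blast
  qed
  have time: "runs_in_time C.Q D t"
    unfolding runs_in_time_def
  proof (intro exI[of _ "\<lambda>N. C.K * T N"] conjI ballI)
    show "(\<lambda>N. real (C.K * T N)) \<in> O(t)" using T(1) by simp
    show "\<exists>n \<le> C.K * T (length x). halted C.Q (run C.Q x n)" if "x \<in> D" for x
      using sim[OF that] by (meson le_trans mult_le_mono2)
  qed
  have simul: "simulates C.Q P D"
    unfolding simulates_def
  proof (intro ballI allI)
    fix x y assume "x \<in> D"
    then obtain h n where "halted P (run P x h)" "halted C.Q (run C.Q x n)"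
      "out (run C.Q x n) = out (run P x h)" using sim by blast
    then show "computes C.Q x y \<longleftrightarrow> computes P x y" by (simp add: computes_iff)
  qed
  show ?thesis using wf one within vals space time simul by blast
qed

end
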